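(* Over $\mathsf{RCA}_0$, for each $k\in\mathbb{N}$, $\mathsf{RT}^1_k$ implies $\mathsf{PRT}^1_k$.
   Context: $\mathsf{RT}^1_k$ states: for every $f:\mathbb{N}\rightarrow\{1,\dots,k\}$ there is an infinite $H\subseteq\mathbb{N}$ on which $f$ is constant. $\mathsf{PRT}^1_k$ states: for every $\phi:\mathbb{N}\rightarrow\mathbb{N}$ with $(\forall w)[w\rightarrow(\phi(w))^1_{k+1}]$ and every $f:\mathbb{N}\rightarrow\{1,\dots,k\}$, there is $H\subseteq\mathbb{N}$ packed for $\phi$ (i.e. $|H\cap\{1,\dots,w\}|\geq\phi(w)$ for infinitely many $w$) and semi-homogeneous for $f$ (for exponent 1 this means $f$ is constant on $H$). Here $w\rightarrow(m)^1_{j}$ means every coloring of a $w$-element set with $j$ colors has a monochromatic subset of size $m$. *)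

theory Defs
  imports Main
begin

section \<open>The language of second-order arithmetic\<close>

text \<open>
  Number variables and set variables are both named by strings, but form separate name spaces.
  As usual, equality is primitive for numbers only.
\<close>

datatype tm =
    Var string
  | Zero
  | One
  | Add tm tm  (infixl "\<oplus>" 65)
  | Mul tm tm  (infixl "\<otimes>" 70)

datatype fm =
    Eq tm tm       (infix "\<doteq>" 55)
  | Less tm tm     (infix "\<prec>" 55)
  | Mem tm string  (infix "\<epsilon>" 55)
  | Neg fm         ("\<sim> _" [54] 54)
  | And fm fm      (infixr "\<^bold>\<and>" 53)
  | Or fm fm       (infixr "\<^bold>\<or>" 52)
  | Imp fm fm      (infixr "\<^bold>\<longrightarrow>" 51)
  | All string fm
  | Ex string fm
  | SAll string fm
  | SEx string fm

abbreviation Iff :: "fm \<Rightarrow> fm \<Rightarrow> fm"  (infix "\<^bold>\<longleftrightarrow>" 50) where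
  "p \<^bold>\<longleftrightarrow> q \<equiv> (p \<^bold>\<longrightarrow> q) \<^bold>\<and> (q \<^bold>\<longrightarrow> p)"

abbreviation Leq :: "tm \<Rightarrow> tm \<Rightarrow> fm"  (infix "\<preceq>" 55) where
  "s \<preceq> t \<equiv> (s \<prec> t) \<^bold>\<or> (s \<doteq> t)"

subsection \<open>Semantics\<close>

text \<open>
  In a structure the number variables range over the whole type \<open>'a\<close>, and the set variables
  range over the collection \<open>sets_of\<close>, which need not contain all subsets of \<open>'a\<close>.
\<close>

record 'a l2_struct =
  zero_of :: 'a
  one_of :: 'a
  add_of :: "'a \<Rightarrow> 'a \<Rightarrow> 'a"
  mul_of :: "'a \<Rightarrow> 'a \<Rightarrow> 'a"
  less_of :: "'a \<Rightarrow> 'a \<Rightarrow> bool"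
  sets_of :: "'a set set"

primrec val :: "'a l2_struct \<Rightarrow> (string \<Rightarrow> 'a) \<Rightarrow> tm \<Rightarrow> 'a" where
  "val M e (Var x) = e x"
| "val M e Zero = zero_of M"
| "val M e One = one_of M"
| "val M e (s \<oplus> t) = add_of M (val M e s) (val M e t)"
| "val M e (s \<otimes> t) = mul_of M (val M e s) (val M e t)"

primrec sat :: "'a l2_struct \<Rightarrow> (string \<Rightarrow> 'a) \<Rightarrow> (string \<Rightarrow> 'a set) \<Rightarrow> fm \<Rightarrow> bool" where
  "sat M e v (s \<doteq> t) \<longleftrightarrow> val M e s = val M e t"
| "sat M e v (s \<prec> t) \<longleftrightarrow> less_of M (val M e s) (val M e t)"
| "sat M e v (t \<epsilon> X) \<longleftrightarrow> val M e t \<in> v X"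
| "sat M e v (\<sim> p) \<longleftrightarrow> \<not> sat M e v p"
| "sat M e v (p \<^bold>\<and> q) \<longleftrightarrow> sat M e v p \<and> sat M e v q"
| "sat M e v (p \<^bold>\<or> q) \<longleftrightarrow> sat M e v p \<or> sat M e v q"
| "sat M e v (p \<^bold>\<longrightarrow> q) \<longleftrightarrow> (sat M e v p \<longrightarrow> sat M e v q)"
| "sat M e v (All x p) \<longleftrightarrow> (\<forall>a. sat M (e(x := a)) v p)"
| "sat M e v (Ex x p) \<longleftrightarrow> (\<exists>a. sat M (e(x := a)) v p)"
| "sat M e v (SAll X p) \<longleftrightarrow> (\<forall>A\<in>sets_of M. sat M e (v(X := A)) p)"
| "sat M e v (SEx X p) \<longleftrightarrow> (\<exists>A\<in>sets_of M. sat M e (v(X := A)) p)"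

text \<open>Truth of the universal closure of a formula.\<close>

definition holds :: "'a l2_struct \<Rightarrow> fm \<Rightarrow> bool"  (infix "\<Turnstile>" 48) where
  "M \<Turnstile> p \<longleftrightarrow> (\<forall>e v. range v \<subseteq> sets_of M \<longrightarrow> sat M e v p)"

definition model_of :: "'a l2_struct \<Rightarrow> fm set \<Rightarrow> bool" where
  "model_of M T \<longleftrightarrow> sets_of M \<noteq> {} \<and> (\<forall>p\<in>T. M \<Turnstile> p)"

subsection \<open>Substitution and free set variables\<close>

primrec tvars :: "tm \<Rightarrow> string set" where
  "tvars (Var x) = {x}"
| "tvars Zero = {}"
| "tvars One = {}"
| "tvars (s \<oplus> t) = tvars s \<union> tvars t"
| "tvars (s \<otimes> t) = tvars s \<union> tvars t"

primrec tsubst :: "string \<Rightarrow> tm \<Rightarrow> tm \<Rightarrow> tm" where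
  "tsubst x r (Var y) = (if y = x then r else Var y)"
| "tsubst x r Zero = Zero"
| "tsubst x r One = One"
| "tsubst x r (s \<oplus> t) = tsubst x r s \<oplus> tsubst x r t"
| "tsubst x r (s \<otimes> t) = tsubst x r s \<otimes> tsubst x r t"

text \<open>
  Substitution for the free occurrences of \<open>x\<close>, without renaming of bound variables. It is used
  only for terms \<open>r\<close> that contain no variable other than \<open>x\<close>, so no capture can occur: a free
  occurrence of \<open>x\<close> is never in the scope of a quantifier binding \<open>x\<close>.
\<close>

primrec subst :: "string \<Rightarrow> tm \<Rightarrow> fm \<Rightarrow> fm" where
  "subst x r (s \<doteq> t) = (tsubst x r s \<doteq> tsubst x r t)"
| "subst x r (s \<prec> t) = (tsubst x r s \<prec> tsubst x r t)"
| "subst x r (t \<epsilon> X) = (tsubst x r t \<epsilon> X)"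
| "subst x r (\<sim> p) = (\<sim> subst x r p)"
| "subst x r (p \<^bold>\<and> q) = (subst x r p \<^bold>\<and> subst x r q)"
| "subst x r (p \<^bold>\<or> q) = (subst x r p \<^bold>\<or> subst x r q)"
| "subst x r (p \<^bold>\<longrightarrow> q) = (subst x r p \<^bold>\<longrightarrow> subst x r q)"
| "subst x r (All y p) = All y (if y = x then p else subst x r p)"
| "subst x r (Ex y p) = Ex y (if y = x then p else subst x r p)"
| "subst x r (SAll X p) = SAll X (subst x r p)"
| "subst x r (SEx X p) = SEx X (subst x r p)"

primrec free_svars :: "fm \<Rightarrow> string set" where
  "free_svars (s \<doteq> t) = {}"
| "free_svars (s \<prec> t) = {}"
| "free_svars (t \<epsilon> X) = {X}"
| "free_svars (\<sim> p) = free_svars p"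
| "free_svars (p \<^bold>\<and> q) = free_svars p \<union> free_svars q"
| "free_svars (p \<^bold>\<or> q) = free_svars p \<union> free_svars q"
| "free_svars (p \<^bold>\<longrightarrow> q) = free_svars p \<union> free_svars q"
| "free_svars (All x p) = free_svars p"
| "free_svars (Ex x p) = free_svars p"
| "free_svars (SAll X p) = free_svars p - {X}"
| "free_svars (SEx X p) = free_svars p - {X}"

section \<open>The theory \<open>RCA\<^sub>0\<close>\<close>

inductive bounded :: "fm \<Rightarrow> bool" where
  "bounded (s \<doteq> t)"
| "bounded (s \<prec> t)"
| "bounded (t \<epsilon> X)"
| "bounded p \<Longrightarrow> bounded (\<sim> p)"
| "bounded p \<Longrightarrow> bounded q \<Longrightarrow> bounded (p \<^bold>\<and> q)"
| "bounded p \<Longrightarrow> bounded q \<Longrightarrow> bounded (p \<^bold>\<or> q)"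
| "bounded p \<Longrightarrow> bounded q \<Longrightarrow> bounded (p \<^bold>\<longrightarrow> q)"
| "bounded p \<Longrightarrow> x \<notin> tvars t \<Longrightarrow> bounded (All x (Var x \<prec> t \<^bold>\<longrightarrow> p))"
| "bounded p \<Longrightarrow> x \<notin> tvars t \<Longrightarrow> bounded (Ex x (Var x \<prec> t \<^bold>\<and> p))"

definition Sigma01 :: "fm set" where
  "Sigma01 = {Ex x p | x p. bounded p}"

definition Pi01 :: "fm set" where
  "Pi01 = {All x p | x p. bounded p}"

definition basic_axioms :: "fm set" where
  "basic_axioms = (let m = Var ''m''; n = Var ''n'' in
    { \<sim> (n \<oplus> One \<doteq> Zero),
      m \<oplus> One \<doteq> n \<oplus> One \<^bold>\<longrightarrow> m \<doteq> n,
      m \<oplus> Zero \<doteq> m,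
      m \<oplus> (n \<oplus> One) \<doteq> (m \<oplus> n) \<oplus> One,
      m \<otimes> Zero \<doteq> Zero,
      m \<otimes> (n \<oplus> One) \<doteq> (m \<otimes> n) \<oplus> m,
      \<sim> (m \<prec> Zero),
      m \<prec> n \<oplus> One \<^bold>\<longleftrightarrow> m \<preceq> n })"

definition Sigma01_induction :: "fm set" where
  "Sigma01_induction =
    {subst n Zero p \<^bold>\<and> All n (p \<^bold>\<longrightarrow> subst n (Var n \<oplus> One) p) \<^bold>\<longrightarrow> All n p | n p. p \<in> Sigma01}"

definition Delta01_comprehension :: "fm set" where
  "Delta01_comprehension =
    {All n (p \<^bold>\<longleftrightarrow> q) \<^bold>\<longrightarrow> SEx X (All n (Var n \<epsilon> X \<^bold>\<longleftrightarrow> p)) | n p q X.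
       p \<in> Sigma01 \<and> q \<in> Pi01 \<and> X \<notin> free_svars p}"

definition RCA0 :: "fm set" where
  "RCA0 = basic_axioms \<union> Sigma01_induction \<union> Delta01_comprehension"

section \<open>The principles \<open>RT\<^sup>1\<^sub>k\<close> and \<open>PRT\<^sup>1\<^sub>k\<close> as formulas\<close>

text \<open>
  A class of numbers is given by a function from terms to formulas, a single number by a term.
  Since these arguments end up in the scope of quantifiers, the bound names are chosen such that
  no variable of an argument used below is captured.
\<close>

definition pair :: "tm \<Rightarrow> tm \<Rightarrow> tm" where
  "pair i j = (i \<oplus> j) \<otimes> (i \<oplus> j) \<oplus> i"

definition all_numbers :: "tm \<Rightarrow> fm" where
  "all_numbers t = (t \<doteq> t)"

definition upto1 :: "tm \<Rightarrow> tm \<Rightarrow> fm" where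
  "upto1 n t = (One \<preceq> t \<^bold>\<and> t \<preceq> n)"

text \<open>The function \<open>F : A \<rightarrow> B\<close> is the set of the codes of the pairs \<open>(x, F x)\<close>.\<close>

definition func :: "string \<Rightarrow> (tm \<Rightarrow> fm) \<Rightarrow> (tm \<Rightarrow> fm) \<Rightarrow> fm" where
  "func F A B = (let x = Var ''x''; y = Var ''y''; z = Var ''z'' in
     All ''z'' (z \<epsilon> F \<^bold>\<longrightarrow> Ex ''x'' (Ex ''y'' (A x \<^bold>\<and> B y \<^bold>\<and> z \<doteq> pair x y))) \<^bold>\<and>
     All ''x'' (A x \<^bold>\<longrightarrow>
       Ex ''y'' (pair x y \<epsilon> F \<^bold>\<and> All ''z'' (pair x z \<epsilon> F \<^bold>\<longrightarrow> z \<doteq> y))))"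

definition bijection :: "string \<Rightarrow> (tm \<Rightarrow> fm) \<Rightarrow> (tm \<Rightarrow> fm) \<Rightarrow> fm" where
  "bijection F A B = (let x = Var ''x''; y = Var ''y''; z = Var ''z'' in
     func F A B \<^bold>\<and>
     All ''y'' (B y \<^bold>\<longrightarrow>
       Ex ''x'' (pair x y \<epsilon> F \<^bold>\<and> All ''z'' (pair z y \<epsilon> F \<^bold>\<longrightarrow> z \<doteq> x))))"

text \<open>\<open>A\<close> is finite with exactly \<open>n\<close> elements.\<close>

definition has_card :: "(tm \<Rightarrow> fm) \<Rightarrow> tm \<Rightarrow> fm" where
  "has_card A n = SEx ''E'' (bijection ''E'' (upto1 n) A)"

definition const_on :: "string \<Rightarrow> string \<Rightarrow> fm" where
  "const_on F H = Ex ''c'' (All ''x'' (Var ''x'' \<epsilon> H \<^bold>\<longrightarrow> pair (Var ''x'') (Var ''c'') \<epsilon> F))"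

definition infinite_set :: "string \<Rightarrow> fm" where
  "infinite_set H = All ''b'' (Ex ''x'' (Var ''b'' \<prec> Var ''x'' \<^bold>\<and> Var ''x'' \<epsilon> H))"

text \<open>\<open>w \<rightarrow> (m)\<^sup>1\<^sub>j\<close>\<close>

definition arrow1 :: "tm \<Rightarrow> tm \<Rightarrow> tm \<Rightarrow> fm" where
  "arrow1 w m j =
     SAll ''A'' (has_card (\<lambda>t. t \<epsilon> ''A'') w \<^bold>\<longrightarrow>
       SAll ''C'' (func ''C'' (\<lambda>t. t \<epsilon> ''A'') (upto1 j) \<^bold>\<longrightarrow>
         SEx ''G'' (All ''x'' (Var ''x'' \<epsilon> ''G'' \<^bold>\<longrightarrow> Var ''x'' \<epsilon> ''A'') \<^bold>\<and>
           has_card (\<lambda>t. t \<epsilon> ''G'') m \<^bold>\<and> const_on ''C'' ''G'')))"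

text \<open>\<open>|H \<inter> {1, \<dots>, w}| \<ge> \<phi> w\<close> for infinitely many \<open>w\<close>\<close>

definition packed :: "string \<Rightarrow> string \<Rightarrow> fm" where
  "packed Phi H = (let b = Var ''b''; w = Var ''w''; m = Var ''m''; n = Var ''n'' in
     All ''b'' (Ex ''w'' (b \<prec> w \<^bold>\<and>
       Ex ''m'' (pair w m \<epsilon> Phi \<^bold>\<and>
         Ex ''n'' (has_card (\<lambda>t. t \<epsilon> H \<^bold>\<and> upto1 w t) n \<^bold>\<and> m \<preceq> n)))))"

definition RT1 :: "tm \<Rightarrow> fm" where
  "RT1 k =
     SAll ''F'' (func ''F'' all_numbers (upto1 k) \<^bold>\<longrightarrow>
       SEx ''H'' (infinite_set ''H'' \<^bold>\<and> const_on ''F'' ''H''))"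

definition PRT1 :: "tm \<Rightarrow> fm" where
  "PRT1 k = (let w = Var ''w''; m = Var ''m'' in
     SAll ''Phi'' (func ''Phi'' all_numbers all_numbers \<^bold>\<and>
       All ''w'' (All ''m'' (pair w m \<epsilon> ''Phi'' \<^bold>\<longrightarrow> arrow1 w m (k \<oplus> One))) \<^bold>\<longrightarrow>
       SAll ''F'' (func ''F'' all_numbers (upto1 k) \<^bold>\<longrightarrow>
         SEx ''H'' (packed ''Phi'' ''H'' \<^bold>\<and> const_on ''F'' ''H''))))"

end

(* Given \<open>F\<close> with \<open>k\<close> colours and \<open>\<phi>\<close>, let \<open>c i w\<close> be the number of \<open>x\<close> in {1, ..., w} of colour \<open>i\<close>.
   Applying w --> (\<phi> w) to \<open>F\<close> on {1, ..., w} gives a colour \<open>i\<close> with \<open>c i w\<close> at least \<open>\<phi> w\<close>;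
   let \<open>g w\<close> be the least such \<open>i\<close>. By RT1, \<open>g\<close> takes some value \<open>i\<close> on an infinite set, so the class
   of colour \<open>i\<close> is packed for \<open>\<phi>\<close>.

   In a model of RCA0 the function \<open>c\<close> has to be shown to exist as a set of the model. Its graph is
   Delta-0-1 because computations of \<open>c\<close> are coded by numbers, for which divisibility by the terms of
   an arithmetic progression suffices in place of the Chinese remainder theorem. The set of pairs (w, i)
   with \<open>i\<close> large at \<open>w\<close> is then bounded in \<open>c\<close>, since \<open>c i w\<close> is at most \<open>w\<close>. *)

theory Submission
  imports Defs
begin

section \<open>Substitution and free set variables\<close>

lemma val_tsubst: "tvars r \<subseteq> {x} \<Longrightarrow> val M e (tsubst x r t) = val M (e(x := val M e r)) t"
  by (induction t) auto

lemma val_cong: "(\<And>x. x \<in> tvars t \<Longrightarrow> e x = e' x) \<Longrightarrow> val M e t = val M e' t"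
  by (induction t) auto

text \<open>Under a quantifier over some \<open>y\<close> other than \<open>x\<close> the value of
  \<open>r\<close> does not change, because \<open>r\<close> contains at most \<open>x\<close>;
  under a quantifier over \<open>x\<close> itself the substitution stops and the update is
  overwritten.\<close>

lemma sat_subst: "tvars r \<subseteq> {x} \<Longrightarrow> sat M e v (subst x r p) \<longleftrightarrow> sat M (e(x := val M e r)) v p"
proof (induction p arbitrary: e v)
  case (All y p)
  show ?case
  proof (cases "y = x")
    case True
    then show ?thesis by (simp only: subst.simps sat.simps simp_thms if_True fun_upd_upd)
  next
    case False
    have v: "val M (e(y := a)) r = val M e r" for a
      using False All.prems by (intro val_cong) auto
    have "sat M e v (subst x r (All y p)) \<longleftrightarrow> (\<forall>a. sat M ((e(y := a))(x := val M (e(y := a)) r)) v p)"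
      by (simp only: False subst.simps sat.simps if_False All.IH[OF All.prems])
    then show ?thesis
      by (simp only: v sat.simps fun_upd_twist[OF False])
  qed
next
  case (Ex y p)
  show ?case
  proof (cases "y = x")
    case True
    then show ?thesis by (simp only: subst.simps sat.simps simp_thms if_True fun_upd_upd)
  next
    case False
    have v: "val M (e(y := a)) r = val M e r" for a
      using False Ex.prems by (intro val_cong) auto
    have "sat M e v (subst x r (Ex y p)) \<longleftrightarrow> (\<exists>a. sat M ((e(y := a))(x := val M (e(y := a)) r)) v p)"
      by (simp only: False subst.simps sat.simps if_False Ex.IH[OF Ex.prems])
    then show ?thesis
      by (simp only: v sat.simps fun_upd_twist[OF False])
  qed
qed (simp_all add: val_tsubst)

text \<open>Needed for comprehension: interpreting the fresh variable \<open>X\<close> by the new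
  set must not change the formula that defines this set.\<close>

lemma sat_free_svars_cong:
  "(\<And>X. X \<in> free_svars p \<Longrightarrow> v X = v' X) \<Longrightarrow> sat M e v p \<longleftrightarrow> sat M e v' p"
proof (induction p arbitrary: e v v')
  case (SAll X p)
  have "sat M e (v(X := A)) p \<longleftrightarrow> sat M e (v'(X := A)) p" for A
    using SAll.prems by (intro SAll.IH) auto
  then show ?case by simp
next
  case (SEx X p)
  have "sat M e (v(X := A)) p \<longleftrightarrow> sat M e (v'(X := A)) p" for A
    using SEx.prems by (intro SEx.IH) auto
  then show ?case by simp
next
  case (And p q)
  have "sat M e v p \<longleftrightarrow> sat M e v' p" "sat M e v q \<longleftrightarrow> sat M e v' q"
    using And.prems by (intro And.IH; simp)+
  then show ?case by simp
next
  case (Or p q)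
  have "sat M e v p \<longleftrightarrow> sat M e v' p" "sat M e v q \<longleftrightarrow> sat M e v' q"
    using Or.prems by (intro Or.IH; simp)+
  then show ?case by simp
next
  case (Imp p q)
  have "sat M e v p \<longleftrightarrow> sat M e v' p" "sat M e v q \<longleftrightarrow> sat M e v' q"
    using Imp.prems by (intro Imp.IH; simp)+
  then show ?case by simp
next
  case (Neg p)
  have "sat M e v p \<longleftrightarrow> sat M e v' p" for e
    using Neg.prems by (intro Neg.IH) simp
  then show ?case by simp
next
  case (All x p)
  have "sat M e v p \<longleftrightarrow> sat M e v' p" for e
    using All.prems by (intro All.IH) simp
  then show ?case by simp
next
  case (Ex x p)
  have "sat M e v p \<longleftrightarrow> sat M e v' p" for e
    using Ex.prems by (intro Ex.IH) simp
  then show ?case by simp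
qed simp_all

lemma finite_free_svars: "finite (free_svars p)"
  by (induction p) auto

lemma fresh_svar: "\<exists>X. X \<notin> free_svars p"
  using finite_free_svars[of p] infinite_UNIV_listI ex_new_if_finite by blast

abbreviation BAll :: "string \<Rightarrow> tm \<Rightarrow> fm \<Rightarrow> fm" where
  "BAll x t p \<equiv> All x (Var x \<prec> t \<^bold>\<longrightarrow> p)"

abbreviation BEx :: "string \<Rightarrow> tm \<Rightarrow> fm \<Rightarrow> fm" where
  "BEx x t p \<equiv> Ex x (Var x \<prec> t \<^bold>\<and> p)"

declare bounded.intros [simp]

lemma tvars_pair [simp]: "tvars (pair s t) = tvars s \<union> tvars t"
  by (auto simp: pair_def)

section \<open>Induction and comprehension inside a model\<close>

locale rca0 =
  fixes M :: "'a l2_struct"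
  assumes model: "model_of M RCA0"
begin

abbreviation "S \<equiv> sets_of M"
abbreviation zero_M ("\<zero>") where "\<zero> \<equiv> zero_of M"
abbreviation one_M ("\<one>") where "\<one> \<equiv> one_of M"
abbreviation add_M (infixl "+\<^sub>M" 65) where "x +\<^sub>M y \<equiv> add_of M x y"
abbreviation mul_M (infixl "*\<^sub>M" 70) where "x *\<^sub>M y \<equiv> mul_of M x y"
abbreviation less_M (infix "<\<^sub>M" 50) where "x <\<^sub>M y \<equiv> less_of M x y"

definition le_M (infix "\<le>\<^sub>M" 50) where "x \<le>\<^sub>M y \<longleftrightarrow> x <\<^sub>M y \<or> x = y"

definition pr where "pr i j = (i +\<^sub>M j) *\<^sub>M (i +\<^sub>M j) +\<^sub>M i"

lemma val_pair [simp]: "val M e (pair s t) = pr (val M e s) (val M e t)"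
  by (simp add: pair_def pr_def)

lemma axiom_sat: "p \<in> RCA0 \<Longrightarrow> (\<And>X. v X \<in> S) \<Longrightarrow> sat M e v p"
  using model by (simp add: model_of_def holds_def image_subset_iff)

lemma S_nonempty: "S \<noteq> {}"
  using model by (simp add: model_of_def)

lemma
  shows succ_neq_zero: "n +\<^sub>M \<one> \<noteq> \<zero>"
    and succ_inject: "m +\<^sub>M \<one> = n +\<^sub>M \<one> \<Longrightarrow> m = n"
    and add_zero: "m +\<^sub>M \<zero> = m"
    and add_succ: "m +\<^sub>M (n +\<^sub>M \<one>) = (m +\<^sub>M n) +\<^sub>M \<one>"
    and mul_zero: "m *\<^sub>M \<zero> = \<zero>"
    and mul_succ: "m *\<^sub>M (n +\<^sub>M \<one>) = m *\<^sub>M n +\<^sub>M m"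
    and not_less_zero: "\<not> m <\<^sub>M \<zero>"
    and less_succ: "m <\<^sub>M n +\<^sub>M \<one> \<longleftrightarrow> m <\<^sub>M n \<or> m = n"
proof -
  obtain A where A: "A \<in> S" using S_nonempty by blast
  then have "\<forall>p\<in>basic_axioms. sat M ((\<lambda>_. m)(''n'' := n)) (\<lambda>_. A) p"
    by (simp add: axiom_sat RCA0_def)
  then have *: "n +\<^sub>M \<one> \<noteq> \<zero> \<and> (m +\<^sub>M \<one> = n +\<^sub>M \<one> \<longrightarrow> m = n) \<and> m +\<^sub>M \<zero> = m \<and>
    m +\<^sub>M (n +\<^sub>M \<one>) = (m +\<^sub>M n) +\<^sub>M \<one> \<and> m *\<^sub>M \<zero> = \<zero> \<and>
    m *\<^sub>M (n +\<^sub>M \<one>) = m *\<^sub>M n +\<^sub>M m \<and> \<not> m <\<^sub>M \<zero> \<and>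
    (m <\<^sub>M n +\<^sub>M \<one> \<longleftrightarrow> m <\<^sub>M n \<or> m = n)"
    by (simp add: basic_axioms_def Let_def) blast
  show "n +\<^sub>M \<one> \<noteq> \<zero>" "m +\<^sub>M \<one> = n +\<^sub>M \<one> \<Longrightarrow> m = n" "m +\<^sub>M \<zero> = m"
    "m +\<^sub>M (n +\<^sub>M \<one>) = (m +\<^sub>M n) +\<^sub>M \<one>" "m *\<^sub>M \<zero> = \<zero>"
    "m *\<^sub>M (n +\<^sub>M \<one>) = m *\<^sub>M n +\<^sub>M m" "\<not> m <\<^sub>M \<zero>"
    "m <\<^sub>M n +\<^sub>M \<one> \<longleftrightarrow> m <\<^sub>M n \<or> m = n"
    using * by blast+
qed

text \<open>The predicate \<open>P\<close> is the meaning of the matrix \<open>p\<close>, so each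
  use names a formula and lets the simplifier confirm its meaning. The induction step receives the
  witness \<open>b\<close> and builds the next one from it.\<close>

lemma sigma01_induct:
  assumes "bounded p" "\<And>X. v X \<in> S"
    and P: "\<And>a b. sat M (e(n := a, x := b)) v p \<longleftrightarrow> P a b"
    and "\<exists>b. P \<zero> b" "\<And>a b. P a b \<Longrightarrow> \<exists>b. P (a +\<^sub>M \<one>) b"
  shows "\<exists>b. P a b"
proof -
  have "Ex x p \<in> Sigma01" using assms(1) by (auto simp: Sigma01_def)
  then have "subst n Zero (Ex x p) \<^bold>\<and>
      All n (Ex x p \<^bold>\<longrightarrow> subst n (Var n \<oplus> One) (Ex x p)) \<^bold>\<longrightarrow> All n (Ex x p) \<in> Sigma01_induction"
    unfolding Sigma01_induction_def by (intro CollectI exI conjI) (rule refl)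
  then have *: "sat M e v (subst n Zero (Ex x p) \<^bold>\<and>
      All n (Ex x p \<^bold>\<longrightarrow> subst n (Var n \<oplus> One) (Ex x p)) \<^bold>\<longrightarrow> All n (Ex x p))"
    using assms(2) by (intro axiom_sat) (simp_all only: RCA0_def Un_iff simp_thms)
  have 1: "sat M (e(n := a)) v (Ex x p) \<longleftrightarrow> (\<exists>b. P a b)" for a
    by (simp only: sat.simps P)
  have 2: "sat M e v (subst n Zero (Ex x p)) \<longleftrightarrow> sat M (e(n := \<zero>)) v (Ex x p)"
    by (subst sat_subst) simp_all
  have 3: "sat M (e(n := a)) v (subst n (Var n \<oplus> One) (Ex x p)) \<longleftrightarrow>
      sat M (e(n := a +\<^sub>M \<one>)) v (Ex x p)" for a
    by (subst sat_subst) (simp_all del: sat.simps)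
  note * = *[unfolded sat.simps(5,7,8) 1 2 3]
  have "\<forall>a. \<exists>b. P a b"
    by (rule mp[OF *], intro conjI allI impI assms(4), elim exE, rule assms(5))
  then show ?thesis ..
qed

lemma delta01_set:
  assumes "bounded p" "bounded q" "\<And>X. v X \<in> S"
    and P: "\<And>a b. sat M (e(n := a, x := b)) v p \<longleftrightarrow> P a b"
    and Q: "\<And>a b. sat M (e(n := a, y := b)) v q \<longleftrightarrow> Q a b"
    and PQ: "\<And>a. (\<exists>b. P a b) \<longleftrightarrow> (\<forall>b. Q a b)"
  shows "{a. \<exists>b. P a b} \<in> S"
proof -
  obtain X where X: "X \<notin> free_svars (Ex x p)" using fresh_svar by blast
  have 0: "sat M e v (All n (Ex x p \<^bold>\<longleftrightarrow> All y q) \<^bold>\<longrightarrow>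
      SEx X (All n (Var n \<epsilon> X \<^bold>\<longleftrightarrow> Ex x p)))"
  proof (rule axiom_sat)
    show "(All n (Ex x p \<^bold>\<longleftrightarrow> All y q) \<^bold>\<longrightarrow>
      SEx X (All n (Var n \<epsilon> X \<^bold>\<longleftrightarrow> Ex x p))) \<in> RCA0"
      using assms(1,2) X unfolding RCA0_def Delta01_comprehension_def Sigma01_def Pi01_def by blast
  qed (use assms(3) in auto)
  have "sat M e' (v(X := A)) p \<longleftrightarrow> sat M e' v p" for e' A
    using X by (intro sat_free_svars_cong) auto
  note * = this
  have "\<exists>A\<in>S. \<forall>a. a \<in> A \<longleftrightarrow> (\<exists>b. P a b)"
    using 0 by (simp add: P Q PQ * iff_conv_conj_imp fun_upd_same del: fun_upd_apply)
  then obtain A where "A \<in> S" "\<forall>a. a \<in> A \<longleftrightarrow> (\<exists>b. P a b)"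
    by blast
  moreover from this have "A = {a. \<exists>b. P a b}" by auto
  ultimately show ?thesis by simp
qed

text \<open>A bounded formula becomes $\Sigma^0_1$ and $\Pi^0_1$ by a dummy quantifier over
  \<open>''u''\<close>, which therefore must not be used in \<open>p\<close>.\<close>

lemma bounded_set:
  assumes "bounded p" "\<And>X. v X \<in> S"
    and "\<And>a b. sat M (e(''n'' := a, ''u'' := b)) v p \<longleftrightarrow> P a"
  shows "{a. P a} \<in> S"
  using delta01_set[OF assms(1) assms(1) assms(2), where P = "\<lambda>a b. P a" and Q = "\<lambda>a b. P a",
      OF assms(3) assms(3)] by simp

text \<open>Membership in a set of the model is a bounded formula, so this is an instance of
  Sigma-0-1 induction. Later inductions with set parameters therefore first show that the set of
  good numbers lies in \<open>S\<close>.\<close>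

lemma set_induct:
  assumes "{a. P a} \<in> S" "P \<zero>" "\<And>a. P a \<Longrightarrow> P (a +\<^sub>M \<one>)"
  shows "P a"
  using sigma01_induct[of "Var ''n'' \<epsilon> ''A''" "\<lambda>_. {a. P a}" "\<lambda>_. \<zero>" "''n''" "''u''" "\<lambda>a b. P a" a]
    assms by auto

lemma S_some: "(SOME A. A \<in> S) \<in> S"
  using S_nonempty some_in_eq by blast

text \<open>Meant for formulas without set variables: all set variables receive one arbitrary member
  of \<open>S\<close>.\<close>

lemma bounded_induct:
  assumes "bounded p" "\<And>a b. sat M (e(''n'' := a, ''u'' := b)) (\<lambda>_. SOME A. A \<in> S) p \<longleftrightarrow> P a"
    "P \<zero>" "\<And>a. P a \<Longrightarrow> P (a +\<^sub>M \<one>)"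
  shows "P a"
  using bounded_set[OF assms(1) S_some assms(2)] assms(3,4) by (rule set_induct)

section \<open>Arithmetic in the model\<close>

text \<open>The axioms recurse on the right argument only; the equations for the left argument come
  by induction, and commutativity follows from both.\<close>

lemma zero_add: "\<zero> +\<^sub>M a = a"
  by (rule bounded_induct[of "Zero \<oplus> Var ''n'' \<doteq> Var ''n''" _ _ a])
    (auto simp: add_zero add_succ)

lemma succ_add: "(m +\<^sub>M \<one>) +\<^sub>M a = m +\<^sub>M a +\<^sub>M \<one>"
  by (rule bounded_induct[of "(Var ''m'' \<oplus> One) \<oplus> Var ''n'' \<doteq> (Var ''m'' \<oplus> Var ''n'') \<oplus> One" "\<lambda>_. m" _ a])
    (auto simp: add_zero add_succ)

lemma add_commute: "m +\<^sub>M a = a +\<^sub>M m"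
  by (rule bounded_induct[of "Var ''m'' \<oplus> Var ''n'' \<doteq> Var ''n'' \<oplus> Var ''m''" "\<lambda>_. m" _ a])
    (auto simp: add_zero add_succ zero_add succ_add)

lemma add_assoc: "m +\<^sub>M k +\<^sub>M a = m +\<^sub>M (k +\<^sub>M a)"
  by (rule bounded_induct[of "(Var ''m'' \<oplus> Var ''k'') \<oplus> Var ''n'' \<doteq> Var ''m'' \<oplus> (Var ''k'' \<oplus> Var ''n'')"
      "(\<lambda>_. m)(''k'' := k)" _ a])
    (auto simp: add_zero add_succ)

lemma add_left_commute: "a +\<^sub>M (b +\<^sub>M c) = b +\<^sub>M (a +\<^sub>M c)"
  by (metis add_assoc add_commute)

lemmas add_ac_M = add_assoc add_commute add_left_commute

lemma zero_mul: "\<zero> *\<^sub>M a = \<zero>"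
  by (rule bounded_induct[of "Zero \<otimes> Var ''n'' \<doteq> Zero" _ _ a])
    (auto simp: add_zero mul_zero mul_succ)

lemma succ_mul: "(m +\<^sub>M \<one>) *\<^sub>M a = m *\<^sub>M a +\<^sub>M a"
  by (rule bounded_induct[of "(Var ''m'' \<oplus> One) \<otimes> Var ''n'' \<doteq> Var ''m'' \<otimes> Var ''n'' \<oplus> Var ''n''" "\<lambda>_. m" _ a])
    (auto simp: add_zero mul_zero mul_succ add_ac_M)

lemma mul_commute: "m *\<^sub>M a = a *\<^sub>M m"
  by (rule bounded_induct[of "Var ''m'' \<otimes> Var ''n'' \<doteq> Var ''n'' \<otimes> Var ''m''" "\<lambda>_. m" _ a])
    (auto simp: mul_zero zero_mul mul_succ succ_mul)

lemma distrib_left: "m *\<^sub>M (k +\<^sub>M a) = m *\<^sub>M k +\<^sub>M m *\<^sub>M a"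
  by (rule bounded_induct[of "Var ''m'' \<otimes> (Var ''k'' \<oplus> Var ''n'') \<doteq> Var ''m'' \<otimes> Var ''k'' \<oplus> Var ''m'' \<otimes> Var ''n''"
      "(\<lambda>_. m)(''k'' := k)" _ a])
    (auto simp: add_zero mul_zero mul_succ add_assoc[symmetric])

lemma mul_one: "a *\<^sub>M \<one> = a"
  by (metis mul_succ mul_zero zero_add)

lemma mul_assoc: "m *\<^sub>M k *\<^sub>M a = m *\<^sub>M (k *\<^sub>M a)"
  by (rule bounded_induct[of "(Var ''m'' \<otimes> Var ''k'') \<otimes> Var ''n'' \<doteq> Var ''m'' \<otimes> (Var ''k'' \<otimes> Var ''n'')"
      "(\<lambda>_. m)(''k'' := k)" _ a])
    (auto simp: mul_zero mul_succ mul_one distrib_left)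

lemma add_right_cancel: "b +\<^sub>M a = c +\<^sub>M a \<longleftrightarrow> b = c"
proof -
  have "b +\<^sub>M a = c +\<^sub>M a \<longrightarrow> b = c"
    by (rule bounded_induct[of "(Var ''b'' \<oplus> Var ''n'' \<doteq> Var ''c'' \<oplus> Var ''n'') \<^bold>\<longrightarrow> Var ''b'' \<doteq> Var ''c''"
      "(\<lambda>_. b)(''c'' := c)" _ a])
    (auto simp: add_zero add_assoc[symmetric] dest: succ_inject)
  then show ?thesis by auto
qed

lemma less_add_succ: "m <\<^sub>M m +\<^sub>M (a +\<^sub>M \<one>)"
  by (rule bounded_induct[of "Var ''m'' \<prec> Var ''m'' \<oplus> (Var ''n'' \<oplus> One)" "\<lambda>_. m" _ a])
    (auto simp: less_succ add_zero add_succ)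

text \<open>The axioms describe the order only by recursion on its right argument; this ties it to
  addition. The difference \<open>d\<close> is the witness of a Sigma-0-1 induction on the larger
  number, and the new case \<open>m = a\<close> of \<open>less_succ\<close> has
  \<open>d = \<zero>\<close>.\<close>

lemma less_iff_ex: "m <\<^sub>M n \<longleftrightarrow> (\<exists>d. n = m +\<^sub>M (d +\<^sub>M \<one>))"
proof
  have "\<exists>d. m <\<^sub>M n \<longrightarrow> n = m +\<^sub>M (d +\<^sub>M \<one>)"
  proof (rule sigma01_induct[of "Var ''m'' \<prec> Var ''n'' \<^bold>\<longrightarrow> Var ''n'' \<doteq> Var ''m'' \<oplus> (Var ''d'' \<oplus> One)"
      "\<lambda>_. SOME A. A \<in> S" "\<lambda>_. m" "''n''" "''d''" "\<lambda>a d. m <\<^sub>M a \<longrightarrow> a = m +\<^sub>M (d +\<^sub>M \<one>)"])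
    show "\<exists>d. m <\<^sub>M a +\<^sub>M \<one> \<longrightarrow> a +\<^sub>M \<one> = m +\<^sub>M (d +\<^sub>M \<one>)"
      if "m <\<^sub>M a \<longrightarrow> a = m +\<^sub>M (b +\<^sub>M \<one>)" for a b
      using that by (metis add_succ add_zero less_succ)
  qed (auto simp: not_less_zero S_some)
  then show "m <\<^sub>M n \<Longrightarrow> \<exists>d. n = m +\<^sub>M (d +\<^sub>M \<one>)" by blast
qed (auto simp: less_add_succ)

lemma zero_or_succ: "a = \<zero> \<or> (\<exists>b. a = b +\<^sub>M \<one>)"
proof -
  have "\<exists>b. a = \<zero> \<or> a = b +\<^sub>M \<one>"
    by (rule sigma01_induct[of "Var ''n'' \<doteq> Zero \<^bold>\<or> Var ''n'' \<doteq> Var ''d'' \<oplus> One"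
      "\<lambda>_. SOME A. A \<in> S" "\<lambda>_. a" "''n''" "''d''" "\<lambda>a b. a = \<zero> \<or> a = b +\<^sub>M \<one>"]) (auto simp: S_some)
  then show ?thesis by blast
qed

lemma le_iff_ex: "m \<le>\<^sub>M n \<longleftrightarrow> (\<exists>d. n = m +\<^sub>M d)"
  by (metis add_zero le_M_def less_iff_ex zero_or_succ)

lemma less_irrefl: "\<not> a <\<^sub>M a"
  by (metis add_commute add_right_cancel less_iff_ex succ_neq_zero zero_add)

lemma less_trans: "a <\<^sub>M b \<Longrightarrow> b <\<^sub>M c \<Longrightarrow> a <\<^sub>M c"
  unfolding less_iff_ex by (metis add_assoc)

lemma zero_le: "\<zero> \<le>\<^sub>M a"
  using le_iff_ex zero_add by metis

lemma less_linear: "m <\<^sub>M a \<or> m = a \<or> a <\<^sub>M m"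
proof (rule bounded_induct[of "Var ''m'' \<prec> Var ''n'' \<^bold>\<or> Var ''m'' \<doteq> Var ''n'' \<^bold>\<or> Var ''n'' \<prec> Var ''m''" "\<lambda>_. m" _ a])
  show "m <\<^sub>M \<zero> \<or> m = \<zero> \<or> \<zero> <\<^sub>M m" using zero_le le_M_def by auto
next
  fix b assume "m <\<^sub>M b \<or> m = b \<or> b <\<^sub>M m"
  then show "m <\<^sub>M b +\<^sub>M \<one> \<or> m = b +\<^sub>M \<one> \<or> b +\<^sub>M \<one> <\<^sub>M m"
  proof (elim disjE)
    assume "b <\<^sub>M m"
    then obtain d where "m = b +\<^sub>M (d +\<^sub>M \<one>)" using less_iff_ex by auto
    then have d: "m = (b +\<^sub>M \<one>) +\<^sub>M d" by (simp add: add_ac_M)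
    show ?thesis
    proof (cases "d = \<zero>")
      case True
      then show ?thesis using d by (simp add: add_zero)
    next
      case False
      then have "b +\<^sub>M \<one> <\<^sub>M m" using d zero_or_succ less_iff_ex by metis
      then show ?thesis by blast
    qed
  qed (auto simp: less_succ)
qed auto

text \<open>Truncated subtraction, one of the operations of
  \<open>linordered_semidom\<close>.\<close>

definition minus_M (infixl "-\<^sub>M" 65) where
  "a -\<^sub>M b = (if b \<le>\<^sub>M a then THE d. a = b +\<^sub>M d else \<zero>)"

lemma le_add: "a \<le>\<^sub>M a +\<^sub>M b"
  by (auto simp: le_iff_ex)

lemma add_diff: "(b +\<^sub>M d) -\<^sub>M b = d"
proof -
  have "(THE e. b +\<^sub>M d = b +\<^sub>M e) = d"
    by (rule the_equality) (metis add_right_cancel add_commute)+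
  then show ?thesis by (simp add: minus_M_def le_add)
qed

lemma diff_eq_zero: "a \<le>\<^sub>M b \<Longrightarrow> a -\<^sub>M b = \<zero>"
  by (metis add_diff add_zero le_M_def less_irrefl less_trans minus_M_def)

lemma le_linear: "a \<le>\<^sub>M b \<or> b \<le>\<^sub>M a"
  using less_linear le_M_def by blast

lemma le_trans: "a \<le>\<^sub>M b \<Longrightarrow> b \<le>\<^sub>M c \<Longrightarrow> a \<le>\<^sub>M c"
  unfolding le_iff_ex by (metis add_assoc)

lemma diff_diff: "a -\<^sub>M b -\<^sub>M c = a -\<^sub>M (b +\<^sub>M c)"
proof (cases "b \<le>\<^sub>M a")
  case True
  then obtain d where d: "a = b +\<^sub>M d" using le_iff_ex by auto
  show ?thesis
  proof (cases "c \<le>\<^sub>M d")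
    case True
    then obtain e where "d = c +\<^sub>M e" using le_iff_ex by auto
    then show ?thesis using d by (metis add_assoc add_diff)
  next
    case False
    then obtain e where "c = d +\<^sub>M e" using le_linear le_iff_ex by metis
    then show ?thesis using d by (metis add_assoc add_diff diff_eq_zero le_add)
  qed
next
  case False
  then have "a \<le>\<^sub>M b" using le_linear by blast
  then have "a \<le>\<^sub>M b +\<^sub>M c" using le_trans le_add by blast
  then show ?thesis using \<open>a \<le>\<^sub>M b\<close> by (simp add: diff_eq_zero zero_le)
qed

lemma mul_diff_distrib: "a *\<^sub>M (b -\<^sub>M c) = a *\<^sub>M b -\<^sub>M a *\<^sub>M c"
proof (cases "c \<le>\<^sub>M b")
  case True
  then show ?thesis by (metis add_diff distrib_left le_iff_ex)
next
  case False
  then obtain d where "c = b +\<^sub>M d" using le_linear le_iff_ex by metis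
  then show ?thesis by (simp add: diff_eq_zero distrib_left le_add mul_zero)
qed

lemma add_le_left_mono: "a \<le>\<^sub>M b \<Longrightarrow> c +\<^sub>M a \<le>\<^sub>M c +\<^sub>M b"
  unfolding le_iff_ex by (metis add_assoc)

lemma mul_less_left_mono:
  assumes "a <\<^sub>M b" "\<zero> <\<^sub>M c"
  shows "c *\<^sub>M a <\<^sub>M c *\<^sub>M b"
proof -
  obtain d where "b = a +\<^sub>M (d +\<^sub>M \<one>)" using assms less_iff_ex by auto
  moreover obtain e where "c = e +\<^sub>M \<one>" using assms less_irrefl zero_or_succ by metis
  ultimately have "c *\<^sub>M b = c *\<^sub>M a +\<^sub>M (c *\<^sub>M d +\<^sub>M e +\<^sub>M \<one>)"
    by (simp add: distrib_left mul_one add_assoc)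
  then show ?thesis unfolding less_iff_ex by blast
qed

lemma mul_eq_zero: "a *\<^sub>M b = \<zero> \<Longrightarrow> a = \<zero> \<or> b = \<zero>"
  by (metis le_M_def less_irrefl mul_less_left_mono mul_zero zero_le)

text \<open>Makes the general facts on ordered semirings and divisibility available for the
  model.\<close>

sublocale arith: linordered_semidom "(+\<^sub>M)" "(-\<^sub>M)" "(\<le>\<^sub>M)" "(<\<^sub>M)" \<zero> "(*\<^sub>M)" \<one>
proof unfold_locales
  fix a b c
  show "a <\<^sub>M b \<longleftrightarrow> a \<le>\<^sub>M b \<and> \<not> b \<le>\<^sub>M a" "a \<le>\<^sub>M a" "a \<le>\<^sub>M b \<Longrightarrow> b \<le>\<^sub>M a \<Longrightarrow> a = b"
    using less_irrefl less_trans less_linear unfolding le_M_def by blast+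
  show "(a +\<^sub>M b) *\<^sub>M c = a *\<^sub>M c +\<^sub>M b *\<^sub>M c" "\<one> *\<^sub>M a = a"
    by (simp_all add: mul_commute[of _ c] mul_commute[of \<one>] distrib_left mul_one)
  show "\<zero> \<noteq> \<one>"
    by (metis succ_neq_zero zero_add)
  then show "\<zero> <\<^sub>M \<one>"
    using zero_le le_M_def by blast
  show "a *\<^sub>M b \<noteq> \<zero>" if "a \<noteq> \<zero>" "b \<noteq> \<zero>"
    using that mul_eq_zero by blast
  show "a -\<^sub>M b +\<^sub>M b = a" if "b \<le>\<^sub>M a"
    using that by (metis add_diff le_iff_ex add_commute)
qed (fact add_assoc add_commute add_diff diff_diff zero_add le_trans le_linear add_le_left_mono
  mul_assoc mul_commute mul_diff_distrib mul_less_left_mono distrib_left mul_zero zero_mul)+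

lemma less_succ_iff [simp]: "a <\<^sub>M b +\<^sub>M \<one> \<longleftrightarrow> a \<le>\<^sub>M b"
  by (simp add: less_succ le_M_def)

lemma succ_le_iff: "a +\<^sub>M \<one> \<le>\<^sub>M b \<longleftrightarrow> a <\<^sub>M b"
  by (metis arith.not_less less_succ_iff)

declare zero_le [simp]

lemma zero_less_iff: "\<zero> <\<^sub>M a \<longleftrightarrow> a \<noteq> \<zero>"
  using zero_le[of a] by (auto simp: le_M_def less_irrefl)

lemma one_le_iff: "\<one> \<le>\<^sub>M a \<longleftrightarrow> a \<noteq> \<zero>"
  by (metis arith.add_0 arith.not_less succ_le_iff le_M_def zero_le)

lemma le_mul_self: "a \<le>\<^sub>M a *\<^sub>M a"
  by (metis arith.mult_left_mono arith.mult_1_right one_le_iff zero_le arith.order.refl arith.mult_zero_right)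

section \<open>The pairing code\<close>

text \<open>Both components are at most the code, so formulas that decode \<open>n\<close> may bound
  their quantifiers by \<open>n + 1\<close>.\<close>

lemma le_pr: "i \<le>\<^sub>M pr i j" "j \<le>\<^sub>M pr i j"
proof -
  show "i \<le>\<^sub>M pr i j" by (simp add: pr_def)
  have "j \<le>\<^sub>M i +\<^sub>M j" by simp
  also have "\<dots> \<le>\<^sub>M (i +\<^sub>M j) *\<^sub>M (i +\<^sub>M j)" by (rule le_mul_self)
  also have "\<dots> \<le>\<^sub>M pr i j" by (simp add: pr_def)
  finally show "j \<le>\<^sub>M pr i j" .
qed

lemma pr_mono: "i \<le>\<^sub>M i' \<Longrightarrow> j \<le>\<^sub>M j' \<Longrightarrow> pr i j \<le>\<^sub>M pr i' j'"
  unfolding pr_def by (intro arith.add_mono arith.mult_mono) simp_all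

text \<open>With \<open>s = i + j\<close> the code lies between \<open>s^2\<close> and
  \<open>s^2 + s\<close>, and the latter is below \<open>(s + 1)^2\<close>. Hence a code determines
  the sum of its components, which gives injectivity.\<close>

lemma pr_less: "i +\<^sub>M j <\<^sub>M i' +\<^sub>M j' \<Longrightarrow> pr i j <\<^sub>M pr i' j'"
proof -
  define s t where "s = i +\<^sub>M j" and "t = i' +\<^sub>M j'"
  assume "i +\<^sub>M j <\<^sub>M i' +\<^sub>M j'"
  then have st: "s +\<^sub>M \<one> \<le>\<^sub>M t" by (simp add: s_def t_def succ_le_iff)
  have "pr i j \<le>\<^sub>M s *\<^sub>M s +\<^sub>M s" by (simp add: pr_def s_def)
  also have "\<dots> <\<^sub>M (s +\<^sub>M \<one>) *\<^sub>M (s +\<^sub>M \<one>)"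
    using less_add_succ[of "s *\<^sub>M s +\<^sub>M s" s] by (simp add: algebra_simps)
  also have "\<dots> \<le>\<^sub>M t *\<^sub>M t" using st by (intro arith.mult_mono) simp_all
  also have "\<dots> \<le>\<^sub>M pr i' j'" by (simp add: pr_def t_def)
  finally show ?thesis .
qed

lemma pr_inject [simp]: "pr i j = pr i' j' \<longleftrightarrow> i = i' \<and> j = j'"
proof
  assume *: "pr i j = pr i' j'"
  then have "i +\<^sub>M j = i' +\<^sub>M j'"
    by (metis pr_less arith.less_irrefl arith.linorder_cases)
  with * show "i = i' \<and> j = j'" by (simp add: pr_def)
qed simp

section \<open>Coding of finite sets\<close>

abbreviation dvd_M (infix "dvd\<^sub>M" 50) where "a dvd\<^sub>M b \<equiv> dvd.dvd (*\<^sub>M) a b"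

text \<open>A nonzero divisor keeps the quotient at most \<open>b\<close>, so divisibility can be
  written as a bounded formula.\<close>

lemma dvd_iff_bounded: "a dvd\<^sub>M b \<longleftrightarrow> (\<exists>q. q \<le>\<^sub>M b \<and> b = a *\<^sub>M q)"
proof
  assume "a dvd\<^sub>M b"
  then obtain q where q: "b = a *\<^sub>M q" by (auto simp: arith.dvd_def)
  show "\<exists>q. q \<le>\<^sub>M b \<and> b = a *\<^sub>M q"
  proof (cases "a = \<zero>")
    \<comment> \<open>Here \<open>b\<close> is zero and \<open>q\<close> may be arbitrarily large,
      so the quotient \<open>\<zero>\<close> replaces it.\<close>
    case True
    then show ?thesis using q by (intro exI[of _ \<zero>]) simp
  next
    case False
    then have "\<one> *\<^sub>M q \<le>\<^sub>M a *\<^sub>M q" by (intro arith.mult_right_mono) (simp_all add: one_le_iff)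
    then show ?thesis using q by auto
  qed
qed (auto simp: arith.dvd_def)

definition Dvd :: "tm \<Rightarrow> tm \<Rightarrow> fm" where
  "Dvd s t = BEx ''q'' (t \<oplus> One) (t \<doteq> s \<otimes> Var ''q'')"

lemma bounded_Dvd [simp]: "''q'' \<notin> tvars t \<Longrightarrow> bounded (Dvd s t)"
  by (simp add: Dvd_def)

lemma sat_Dvd [simp]:
  assumes "''q'' \<notin> tvars s" "''q'' \<notin> tvars t"
  shows "sat M e v (Dvd s t) \<longleftrightarrow> val M e s dvd\<^sub>M val M e t"
proof -
  have "val M (e(''q'' := a)) s = val M e s" "val M (e(''q'' := a)) t = val M e t" for a
    using assms by (auto intro!: val_cong)
  then show ?thesis by (simp add: Dvd_def dvd_iff_bounded)
qed

text \<open>The pair $(a, b)$ codes the set of all $i$ such that $(i + 1) b + 1$ divides $a$.\<close>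

definition code_mem where
  "code_mem a b i \<longleftrightarrow> (i +\<^sub>M \<one>) *\<^sub>M b +\<^sub>M \<one> dvd\<^sub>M a"

definition Code_mem :: "string \<Rightarrow> string \<Rightarrow> tm \<Rightarrow> fm" where
  "Code_mem a b t = Dvd ((t \<oplus> One) \<otimes> Var b \<oplus> One) (Var a)"

lemma bounded_Code_mem [simp]: "''q'' \<noteq> a \<Longrightarrow> bounded (Code_mem a b t)"
  by (simp add: Code_mem_def)

lemma sat_Code_mem [simp]:
  "''q'' \<noteq> a \<Longrightarrow> ''q'' \<noteq> b \<Longrightarrow> ''q'' \<notin> tvars t \<Longrightarrow>
    sat M e v (Code_mem a b t) \<longleftrightarrow> code_mem (e a) (e b) (val M e t)"
  by (simp add: Code_mem_def code_mem_def)

text \<open>Takes the place of a factorial, for which recursion would be needed. Being a nonzero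
  common multiple is a bounded condition, so Sigma-0-1 induction applies; the step multiplies by
  \<open>n + 1\<close>.\<close>

lemma exists_common_multiple: "\<exists>b. b \<noteq> \<zero> \<and> (\<forall>t. t \<le>\<^sub>M n \<longrightarrow> t \<noteq> \<zero> \<longrightarrow> t dvd\<^sub>M b)"
proof (rule sigma01_induct[of "\<sim> Var ''b'' \<doteq> Zero \<^bold>\<and>
      BAll ''t'' (Var ''n'' \<oplus> One) (\<sim> Var ''t'' \<doteq> Zero \<^bold>\<longrightarrow> Dvd (Var ''t'') (Var ''b''))"
      "\<lambda>_. SOME A. A \<in> S" "\<lambda>_. \<zero>" "''n''" "''b''"
      "\<lambda>n b. b \<noteq> \<zero> \<and> (\<forall>t. t \<le>\<^sub>M n \<longrightarrow> t \<noteq> \<zero> \<longrightarrow> t dvd\<^sub>M b)"])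
  show "\<exists>b. b \<noteq> \<zero> \<and> (\<forall>t. t \<le>\<^sub>M \<zero> \<longrightarrow> t \<noteq> \<zero> \<longrightarrow> t dvd\<^sub>M b)"
    by (metis arith.order.antisym zero_le arith.zero_neq_one)
  fix n b
  assume b: "b \<noteq> \<zero> \<and> (\<forall>t. t \<le>\<^sub>M n \<longrightarrow> t \<noteq> \<zero> \<longrightarrow> t dvd\<^sub>M b)"
  have "t dvd\<^sub>M b *\<^sub>M (n +\<^sub>M \<one>)" if "t \<le>\<^sub>M n +\<^sub>M \<one>" "t \<noteq> \<zero>" for t
  proof (cases "t = n +\<^sub>M \<one>")
    case True
    then show ?thesis by simp
  next
    case False
    then have "t \<le>\<^sub>M n" using that by (metis less_succ_iff arith.le_less)
    then show ?thesis using b that by (intro arith.dvd_mult2) blast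
  qed
  moreover have "b *\<^sub>M (n +\<^sub>M \<one>) \<noteq> \<zero>" using b succ_neq_zero by simp
  ultimately show "\<exists>b. b \<noteq> \<zero> \<and> (\<forall>t. t \<le>\<^sub>M n +\<^sub>M \<one> \<longrightarrow> t \<noteq> \<zero> \<longrightarrow> t dvd\<^sub>M b)"
    by blast
qed (simp_all add: S_some)

text \<open>All moduli exceed one, so \<open>a = \<one>\<close> codes the empty set, from which
  codes are built up.\<close>

lemma not_code_mem_one: "b \<noteq> \<zero> \<Longrightarrow> \<not> code_mem \<one> b i"
proof
  assume b: "b \<noteq> \<zero>" and "code_mem \<one> b i"
  then obtain q where q: "\<one> = ((i +\<^sub>M \<one>) *\<^sub>M b +\<^sub>M \<one>) *\<^sub>M q"
    by (auto simp: code_mem_def arith.dvd_def)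
  then have "q \<noteq> \<zero>" by auto
  have "\<one> <\<^sub>M ((i +\<^sub>M \<one>) *\<^sub>M b +\<^sub>M \<one>) *\<^sub>M \<one>"
    using b succ_neq_zero by (simp add: zero_less_iff)
  also have "\<dots> \<le>\<^sub>M ((i +\<^sub>M \<one>) *\<^sub>M b +\<^sub>M \<one>) *\<^sub>M q"
    using \<open>q \<noteq> \<zero>\<close> by (intro arith.mult_left_mono) (simp_all add: one_le_iff)
  finally show False using q by simp
qed

text \<open>No coprimality is needed: a suitable combination of the two moduli equals the difference
  of the indices, which divides \<open>b\<close>.\<close>

lemma code_mem_insert:
  assumes b: "\<forall>t. t \<le>\<^sub>M N \<longrightarrow> t \<noteq> \<zero> \<longrightarrow> t dvd\<^sub>M b" and "i \<le>\<^sub>M N" "k \<le>\<^sub>M N"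
  shows "code_mem (a *\<^sub>M ((i +\<^sub>M \<one>) *\<^sub>M b +\<^sub>M \<one>)) b k \<longleftrightarrow> k = i \<or> code_mem a b k"
proof
  define d e where "d = (i +\<^sub>M \<one>) *\<^sub>M b +\<^sub>M \<one>" and "e = (k +\<^sub>M \<one>) *\<^sub>M b +\<^sub>M \<one>"
  \<comment> \<open>As \<open>t\<close> divides \<open>b\<close>, the modulus \<open>e\<close> is
    one more than a multiple of \<open>t\<close>; so \<open>a * e\<close> minus a multiple of
    \<open>a * t\<close> is \<open>a\<close>, and the factor \<open>t\<close> can be
    cancelled.\<close>
  have *: "e dvd\<^sub>M a" if t: "t \<le>\<^sub>M N" "t \<noteq> \<zero>" "e dvd\<^sub>M a *\<^sub>M t" for t
  proof -
    obtain q where q: "b = t *\<^sub>M q" using b t by (auto simp: arith.dvd_def)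
    have "e dvd\<^sub>M (a *\<^sub>M t) *\<^sub>M (q *\<^sub>M (k +\<^sub>M \<one>))" using t(3) by (rule arith.dvd_mult2)
    moreover have "a *\<^sub>M e = (a *\<^sub>M t) *\<^sub>M (q *\<^sub>M (k +\<^sub>M \<one>)) +\<^sub>M a"
      by (simp add: e_def q algebra_simps)
    ultimately show ?thesis by (metis arith.dvd_add_right_iff arith.dvd_triv_right)
  qed
  assume "code_mem (a *\<^sub>M ((i +\<^sub>M \<one>) *\<^sub>M b +\<^sub>M \<one>)) b k"
  then have dvd: "e dvd\<^sub>M a *\<^sub>M d" by (simp add: code_mem_def d_def e_def)
  show "k = i \<or> code_mem a b k"
  proof (rule arith.linorder_cases[of k i])
    assume "k <\<^sub>M i"
    then obtain t where i: "i = k +\<^sub>M t" and t: "t \<noteq> \<zero>"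
      by (metis arith.less_irrefl le_iff_ex arith.less_imp_le arith.add_0_right)
    have "t \<le>\<^sub>M N" using i assms(2) by (metis arith.add.commute le_add arith.order.trans)
    \<comment> \<open>This is \<open>e * (i + 1) - d * (k + 1) = i - k\<close>, multiplied by
      \<open>a\<close> and written without subtraction.\<close>
    moreover have "e *\<^sub>M (a *\<^sub>M (i +\<^sub>M \<one>)) = (a *\<^sub>M d) *\<^sub>M (k +\<^sub>M \<one>) +\<^sub>M a *\<^sub>M t"
      by (simp add: d_def e_def i algebra_simps)
    then have "e dvd\<^sub>M a *\<^sub>M t"
      using dvd by (metis arith.dvd_add_right_iff arith.dvd_triv_left arith.dvd_mult2)
    ultimately show ?thesis using * t by (simp add: code_mem_def e_def)
  next
    assume "i <\<^sub>M k"
    then obtain t where k: "k = i +\<^sub>M t" and t: "t \<noteq> \<zero>"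
      by (metis arith.less_irrefl le_iff_ex arith.less_imp_le arith.add_0_right)
    have "t \<le>\<^sub>M N" using k assms(3) by (metis arith.add.commute le_add arith.order.trans)
    moreover have "(a *\<^sub>M d) *\<^sub>M (k +\<^sub>M \<one>) = e *\<^sub>M (a *\<^sub>M (i +\<^sub>M \<one>)) +\<^sub>M a *\<^sub>M t"
      by (simp add: d_def e_def k algebra_simps)
    then have "e dvd\<^sub>M a *\<^sub>M t"
      using dvd by (metis arith.dvd_add_right_iff arith.dvd_triv_left arith.dvd_mult2)
    ultimately show ?thesis using * t by (simp add: code_mem_def e_def)
  qed simp
next
  assume "k = i \<or> code_mem a b k"
  then show "code_mem (a *\<^sub>M ((i +\<^sub>M \<one>) *\<^sub>M b +\<^sub>M \<one>)) b k"
    by (auto simp: code_mem_def)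
qed

section \<open>Counting\<close>

text \<open>The coded set contains only pairs $(y, u)$ for which \<open>u\<close> is the number of
  $t \in \{1, \dots, y\}$ with $(j, t) \in R$, as long as $y, u \le z$.\<close>

definition trace where
  "trace R j z a b \<longleftrightarrow>
    (\<forall>u. u \<le>\<^sub>M z \<longrightarrow> code_mem a b (pr \<zero> u) \<longrightarrow> u = \<zero>) \<and>
    (\<forall>y. y \<le>\<^sub>M z \<longrightarrow> (\<forall>u. u \<le>\<^sub>M z \<longrightarrow> code_mem a b (pr (y +\<^sub>M \<one>) u) \<longrightarrow>
      (\<exists>u'. u' \<le>\<^sub>M y \<and> code_mem a b (pr y u') \<and>
        u = (if pr j (y +\<^sub>M \<one>) \<in> R then u' +\<^sub>M \<one> else u'))))"

definition Trace :: fm where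
  "Trace = (let y = Var ''y''; u = Var ''u''; w = Var ''w''; z = Var ''z'' in
     BAll ''u'' (z \<oplus> One) (Code_mem ''a'' ''b'' (pair Zero u) \<^bold>\<longrightarrow> u \<doteq> Zero) \<^bold>\<and>
     BAll ''y'' (z \<oplus> One) (BAll ''u'' (z \<oplus> One) (Code_mem ''a'' ''b'' (pair (y \<oplus> One) u) \<^bold>\<longrightarrow>
       BEx ''w'' (y \<oplus> One) (Code_mem ''a'' ''b'' (pair y w) \<^bold>\<and>
         (pair (Var ''j'') (y \<oplus> One) \<epsilon> ''R'' \<^bold>\<and> u \<doteq> w \<oplus> One \<^bold>\<or>
          \<sim> pair (Var ''j'') (y \<oplus> One) \<epsilon> ''R'' \<^bold>\<and> u \<doteq> w)))))"

lemma bounded_Trace [simp]: "bounded Trace"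
  by (simp add: Trace_def Let_def)

lemma sat_Trace [simp]:
  "sat M e v Trace \<longleftrightarrow> trace (v ''R'') (e ''j'') (e ''z'') (e ''a'') (e ''b'')"
proof -
  have "(c \<and> x = a \<or> \<not> c \<and> x = b) \<longleftrightarrow> x = (if c then a else b)" for c and x a b :: 'a
    by auto
  then show ?thesis by (simp add: Trace_def Let_def trace_def split del: if_split)
qed

lemma trace_mono: "trace R j z a b \<Longrightarrow> x \<le>\<^sub>M z \<Longrightarrow> trace R j x a b"
  unfolding trace_def by (meson arith.order.trans)

text \<open>Each recorded value at \<open>y + 1\<close> comes from a recorded value at
  \<open>y\<close> by the same rule, so two codes agree by induction on \<open>y\<close>.
  Quantifying values only up to \<open>x\<close> keeps the induction formula bounded.\<close>

lemma trace_unique: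
  assumes "trace R j x a b" "trace R j x a' b'" "y \<le>\<^sub>M x" "u \<le>\<^sub>M x" "w \<le>\<^sub>M x"
    and "code_mem a b (pr y u)" "code_mem a' b' (pr y w)"
  shows "u = w"
proof -
  have "y \<le>\<^sub>M x \<longrightarrow> (\<forall>u. u \<le>\<^sub>M x \<longrightarrow> (\<forall>w. w \<le>\<^sub>M x \<longrightarrow>
    code_mem a b (pr y u) \<longrightarrow> code_mem a' b' (pr y w) \<longrightarrow> u = w))"
  proof (rule bounded_induct[of "Var ''n'' \<prec> Var ''x'' \<oplus> One \<^bold>\<longrightarrow>
      BAll ''u'' (Var ''x'' \<oplus> One) (BAll ''w'' (Var ''x'' \<oplus> One)
        (Code_mem ''a'' ''b'' (pair (Var ''n'') (Var ''u'')) \<^bold>\<longrightarrow>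
         Code_mem ''c'' ''d'' (pair (Var ''n'') (Var ''w'')) \<^bold>\<longrightarrow> Var ''u'' \<doteq> Var ''w''))"
      "(\<lambda>_. x)(''a'' := a, ''b'' := b, ''c'' := a', ''d'' := b')"])
    fix y
    assume IH: "y \<le>\<^sub>M x \<longrightarrow> (\<forall>u. u \<le>\<^sub>M x \<longrightarrow> (\<forall>w. w \<le>\<^sub>M x \<longrightarrow>
      code_mem a b (pr y u) \<longrightarrow> code_mem a' b' (pr y w) \<longrightarrow> u = w))"
    show "y +\<^sub>M \<one> \<le>\<^sub>M x \<longrightarrow> (\<forall>u. u \<le>\<^sub>M x \<longrightarrow> (\<forall>w. w \<le>\<^sub>M x \<longrightarrow>
      code_mem a b (pr (y +\<^sub>M \<one>) u) \<longrightarrow> code_mem a' b' (pr (y +\<^sub>M \<one>) w) \<longrightarrow> u = w))"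
    proof (intro impI allI)
      fix u w
      assume *: "y +\<^sub>M \<one> \<le>\<^sub>M x" "u \<le>\<^sub>M x" "w \<le>\<^sub>M x"
        "code_mem a b (pr (y +\<^sub>M \<one>) u)" "code_mem a' b' (pr (y +\<^sub>M \<one>) w)"
      then have yx: "y \<le>\<^sub>M x" by (simp add: succ_le_iff arith.less_imp_le)
      obtain u' where u': "u' \<le>\<^sub>M y" "code_mem a b (pr y u')"
          "u = (if pr j (y +\<^sub>M \<one>) \<in> R then u' +\<^sub>M \<one> else u')"
        using assms(1) * yx unfolding trace_def by blast
      obtain w' where w': "w' \<le>\<^sub>M y" "code_mem a' b' (pr y w')"
          "w = (if pr j (y +\<^sub>M \<one>) \<in> R then w' +\<^sub>M \<one> else w')"
        using assms(2) * yx unfolding trace_def by blast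
      \<comment> \<open>The bounds \<open>u' \<le> y\<close> and \<open>w' \<le> y\<close> from
        \<open>trace\<close> place both predecessors in the range of the induction
        hypothesis.\<close>
      have "u' = w'" using IH yx u' w' arith.order.trans by blast
      then show "u = w" using u' w' by simp
    qed
  next
    show "\<zero> \<le>\<^sub>M x \<longrightarrow> (\<forall>u. u \<le>\<^sub>M x \<longrightarrow> (\<forall>w. w \<le>\<^sub>M x \<longrightarrow>
      code_mem a b (pr \<zero> u) \<longrightarrow> code_mem a' b' (pr \<zero> w) \<longrightarrow> u = w))"
      using assms(1,2) unfolding trace_def by blast
  qed simp_all
  then show ?thesis using assms by blast
qed

text \<open>The base \<open>b\<close> is fixed in advance, large enough for all pairs in question;
  the induction on \<open>x\<close> has the number \<open>a\<close> as Sigma-0-1 witness and inserts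
  one pair per step.\<close>

lemma trace_exists:
  assumes R: "R \<in> S"
  obtains a b v where "trace R j z a b" "v \<le>\<^sub>M z" "code_mem a b (pr z v)"
proof -
  \<comment> \<open>One beyond \<open>z\<close>, because \<open>trace\<close> also looks at pairs
    with first component \<open>y + 1\<close> for \<open>y \<le> z\<close>.\<close>
  define N where "N = pr (z +\<^sub>M \<one>) (z +\<^sub>M \<one>)"
  obtain b where "b \<noteq> \<zero>" and b: "\<forall>t. t \<le>\<^sub>M N \<longrightarrow> t \<noteq> \<zero> \<longrightarrow> t dvd\<^sub>M b"
    using exists_common_multiple by blast
  \<comment> \<open>Every stage satisfies \<open>trace\<close> up to the full \<open>z\<close>,
    since this constrains only pairs that are present; what advances is the \<open>x\<close> known
    to have a recorded value. Beyond \<open>z\<close> nothing is claimed.\<close>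
  define P where "P x a \<longleftrightarrow> (x \<le>\<^sub>M z \<longrightarrow> trace R j z a b \<and> (\<exists>v. v \<le>\<^sub>M x \<and> code_mem a b (pr x v)))" for x a
  have le_N: "pr x v \<le>\<^sub>M N" if "x \<le>\<^sub>M z +\<^sub>M \<one>" "v \<le>\<^sub>M z +\<^sub>M \<one>" for x v
    unfolding N_def using that by (rule pr_mono)
  have le_succ: "x \<le>\<^sub>M z \<Longrightarrow> x \<le>\<^sub>M z +\<^sub>M \<one>" for x
    using arith.order.trans le_add by blast
  define ext where "ext a i = a *\<^sub>M ((i +\<^sub>M \<one>) *\<^sub>M b +\<^sub>M \<one>)" for a i
  have ext: "code_mem (ext a (pr x v)) b (pr y u) \<longleftrightarrow> y = x \<and> u = v \<or> code_mem a b (pr y u)"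
    if "x \<le>\<^sub>M z +\<^sub>M \<one>" "v \<le>\<^sub>M z +\<^sub>M \<one>" "y \<le>\<^sub>M z +\<^sub>M \<one>" "u \<le>\<^sub>M z +\<^sub>M \<one>" for a x v y u
    unfolding ext_def using code_mem_insert[OF b le_N le_N] that by simp
  have "\<exists>a. P z a"
  proof (rule sigma01_induct[of "Var ''n'' \<prec> Var ''z'' \<oplus> One \<^bold>\<longrightarrow> Trace \<^bold>\<and>
      BEx ''w'' (Var ''n'' \<oplus> One) (Code_mem ''a'' ''b'' (pair (Var ''n'') (Var ''w'')))"
      "\<lambda>_. R" "(\<lambda>_. z)(''j'' := j, ''b'' := b)" "''n''" "''a''" P])
    \<comment> \<open>Among the pairs in range, this code contains only the pair of zeros.\<close>
    have "trace R j z (ext \<one> (pr \<zero> \<zero>)) b"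
      using not_code_mem_one[OF \<open>b \<noteq> \<zero>\<close>]
      by (auto simp: trace_def ext le_succ arith.add_right_mono succ_neq_zero)
    moreover have "code_mem (ext \<one> (pr \<zero> \<zero>)) b (pr \<zero> \<zero>)"
      by (simp add: ext)
    ultimately have "P \<zero> (ext \<one> (pr \<zero> \<zero>))" unfolding P_def using zero_le by blast
    then show "\<exists>a. P \<zero> a" by blast
  next
    fix x a
    assume Pxa: "P x a"
    show "\<exists>a. P (x +\<^sub>M \<one>) a"
    proof (cases "x +\<^sub>M \<one> \<le>\<^sub>M z")
      case True
      then have xz: "x \<le>\<^sub>M z" by (simp add: succ_le_iff arith.less_imp_le)
      with Pxa obtain v where tr: "trace R j z a b" and v: "v \<le>\<^sub>M x" "code_mem a b (pr x v)"
        unfolding P_def by blast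
      define v' where "v' = (if pr j (x +\<^sub>M \<one>) \<in> R then v +\<^sub>M \<one> else v)"
      have v'x: "v' \<le>\<^sub>M x +\<^sub>M \<one>"
        using v arith.order.trans le_add by (auto simp: v'_def arith.add_right_mono)
      then have v'z: "v' \<le>\<^sub>M z" using True by (rule arith.order.trans)
      define a' where "a' = ext a (pr (x +\<^sub>M \<one>) v')"
      have a': "code_mem a' b (pr y u) \<longleftrightarrow> y = x +\<^sub>M \<one> \<and> u = v' \<or> code_mem a b (pr y u)"
        if "y \<le>\<^sub>M z +\<^sub>M \<one>" "u \<le>\<^sub>M z +\<^sub>M \<one>" for y u
        unfolding a'_def using that v'z True xz by (intro ext) (auto intro: le_succ)
      have "trace R j z a' b"
        unfolding trace_def
      proof (intro conjI allI impI)
        fix u assume "u \<le>\<^sub>M z" "code_mem a' b (pr \<zero> u)"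
        then have "code_mem a b (pr \<zero> u)" using succ_neq_zero[of x] by (auto simp: a' le_succ)
        then show "u = \<zero>" using tr \<open>u \<le>\<^sub>M z\<close> by (auto simp: trace_def)
      next
        fix y u assume yu: "y \<le>\<^sub>M z" "u \<le>\<^sub>M z" "code_mem a' b (pr (y +\<^sub>M \<one>) u)"
        then have "y +\<^sub>M \<one> = x +\<^sub>M \<one> \<and> u = v' \<or> code_mem a b (pr (y +\<^sub>M \<one>) u)"
          by (subst (asm) a') (auto intro: le_succ arith.add_right_mono)
        then have "\<exists>u'. u' \<le>\<^sub>M y \<and> code_mem a b (pr y u') \<and>
            u = (if pr j (y +\<^sub>M \<one>) \<in> R then u' +\<^sub>M \<one> else u')"
        proof
          assume "y +\<^sub>M \<one> = x +\<^sub>M \<one> \<and> u = v'"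
          then have "y = x" "u = v'" by simp_all
          then show ?thesis using v by (auto simp: v'_def)
        next
          assume "code_mem a b (pr (y +\<^sub>M \<one>) u)"
          then show ?thesis using tr yu(1,2) unfolding trace_def by blast
        qed
        then obtain u' where u': "u' \<le>\<^sub>M y" "code_mem a b (pr y u')"
            "u = (if pr j (y +\<^sub>M \<one>) \<in> R then u' +\<^sub>M \<one> else u')"
          by blast
        then have "u' \<le>\<^sub>M z" using yu(1) arith.order.trans by blast
        then have "code_mem a' b (pr y u')" using u'(2) yu(1) by (simp add: a' le_succ)
        then show "\<exists>u'. u' \<le>\<^sub>M y \<and> code_mem a' b (pr y u') \<and>
            u = (if pr j (y +\<^sub>M \<one>) \<in> R then u' +\<^sub>M \<one> else u')"
          using u' by blast
      qed
      moreover have "code_mem a' b (pr (x +\<^sub>M \<one>) v')" using v'z xz by (simp add: a' le_succ)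
      ultimately have "P (x +\<^sub>M \<one>) a'" unfolding P_def using v'x by blast
      then show ?thesis by blast
    qed (simp add: P_def)
  qed (simp_all add: R P_def)
  then show thesis using that unfolding P_def by blast
qed

section \<open>Counting functions as sets of the model\<close>

text \<open>Having the graph in \<open>S\<close> lets bounded formulas mention \<open>c\<close>, and
  \<open>c j x \<le> x\<close> bounds the quantifier that names its value. The argument
  \<open>j\<close> lets one set serve all rows of \<open>R\<close>, hence all colours, at
  once.\<close>

definition counts where
  "counts R c \<longleftrightarrow> {i. \<exists>j x. i = pr (pr j x) (c j x)} \<in> S \<and> (\<forall>j. c j \<zero> = \<zero>) \<and>
    (\<forall>j x. c j (x +\<^sub>M \<one>) = (if pr j (x +\<^sub>M \<one>) \<in> R then c j x +\<^sub>M \<one> else c j x)) \<and>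
    (\<forall>j x. c j x \<le>\<^sub>M x)"

text \<open>The graph is Sigma-0-1 as "some trace records \<open>v\<close>" and Pi-0-1 as "every
  trace records nothing but \<open>v\<close>"; \<open>trace_exists\<close> and
  \<open>trace_unique\<close> make the two agree.\<close>

lemma counts_exists:
  assumes R: "R \<in> S"
  obtains c where "counts R c"
proof -
  define D where "D j x v \<longleftrightarrow> v \<le>\<^sub>M x \<and> (\<exists>a b. trace R j x a b \<and> code_mem a b (pr x v))" for j x v
  have unique: "D j x v \<Longrightarrow> D j x w \<Longrightarrow> v = w" for j x v w
    unfolding D_def using trace_unique by (metis arith.order.refl)
  have "\<exists>v. D j x v" for j x
    using trace_exists[OF R] unfolding D_def by metis
  then obtain c where c: "\<And>j x. D j x (c j x)" by metis
  have D_iff: "D j x v \<longleftrightarrow> v = c j x" for j x v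
    using c unique by blast
  define C where "C = {i. \<exists>j x. i = pr (pr j x) (c j x)}"
  \<comment> \<open>The single unbounded number \<open>s\<close> bounds both parts of the code,
    leaving one unbounded quantifier.\<close>
  define P where "P n s \<longleftrightarrow> (\<exists>a. a <\<^sub>M s \<and> (\<exists>b. b <\<^sub>M s \<and> (\<exists>j. j \<le>\<^sub>M n \<and> (\<exists>z. z \<le>\<^sub>M n \<and>
    (\<exists>v. v \<le>\<^sub>M n \<and> n = pr (pr j z) v \<and> v \<le>\<^sub>M z \<and> trace R j z a b \<and> code_mem a b (pr z v))))))"
    for n s
  define Q where "Q n s \<longleftrightarrow> (\<forall>a. a <\<^sub>M s \<longrightarrow> (\<forall>b. b <\<^sub>M s \<longrightarrow> (\<exists>j. j \<le>\<^sub>M n \<and> (\<exists>z. z \<le>\<^sub>M n \<and>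
    (\<exists>v. v \<le>\<^sub>M n \<and> n = pr (pr j z) v \<and> (trace R j z a b \<longrightarrow>
      (\<forall>w. w \<le>\<^sub>M z \<longrightarrow> code_mem a b (pr z w) \<longrightarrow> w = v)))))))" for n s
  have bound: "a <\<^sub>M a +\<^sub>M b +\<^sub>M \<one>" "b <\<^sub>M a +\<^sub>M b +\<^sub>M \<one>" for a b
    by simp_all
  have pr_bounds: "j \<le>\<^sub>M pr (pr j z) v" "z \<le>\<^sub>M pr (pr j z) v" "v \<le>\<^sub>M pr (pr j z) v" for j z v
    using le_pr arith.order.trans by blast+
  have P: "(\<exists>s. P n s) \<longleftrightarrow> n \<in> C" for n
  proof
    assume "\<exists>s. P n s"
    then obtain j z v where "n = pr (pr j z) v" "D j z v"
      unfolding P_def D_def by blast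
    then show "n \<in> C" using D_iff by (auto simp: C_def)
  next
    assume "n \<in> C"
    then obtain j z where n: "n = pr (pr j z) (c j z)" by (auto simp: C_def)
    obtain a b where "c j z \<le>\<^sub>M z" "trace R j z a b" "code_mem a b (pr z (c j z))"
      using c[of j z] unfolding D_def by blast
    then have "P n (a +\<^sub>M b +\<^sub>M \<one>)" unfolding P_def n using bound pr_bounds by blast
    then show "\<exists>s. P n s" by blast
  qed
  have Q: "(\<forall>s. Q n s) \<longleftrightarrow> n \<in> C" for n
  proof
    assume Q: "\<forall>s. Q n s"
    \<comment> \<open>At \<open>s = \<zero>\<close> the condition is empty;
      \<open>s = \<one>\<close> admits \<open>a = b = \<zero>\<close> and so already shows that
      \<open>n\<close> codes a triple.\<close>
    then have "Q n \<one>" by blast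
    then obtain j z v where n: "n = pr (pr j z) v" unfolding Q_def using arith.zero_less_one by blast
    obtain a b where ab: "c j z \<le>\<^sub>M z" "trace R j z a b" "code_mem a b (pr z (c j z))"
      using c[of j z] unfolding D_def by blast
    \<comment> \<open>In \<open>Q\<close> the decoding depends on \<open>a\<close> and
      \<open>b\<close>, so it is obtained afresh; injectivity of \<open>pr\<close> identifies it
      with \<open>j\<close>, \<open>z\<close>, \<open>v\<close>.\<close>
    obtain j' z' v' where "n = pr (pr j' z') v'"
      "trace R j' z' a b \<longrightarrow> (\<forall>w. w \<le>\<^sub>M z' \<longrightarrow> code_mem a b (pr z' w) \<longrightarrow> w = v')"
      using Q[rule_format, of "a +\<^sub>M b +\<^sub>M \<one>"] bound unfolding Q_def by blast
    then have "v = c j z" using n ab by auto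
    then show "n \<in> C" using n by (auto simp: C_def)
  next
    assume "n \<in> C"
    then obtain j z where n: "n = pr (pr j z) (c j z)" by (auto simp: C_def)
    have "w = c j z" if "trace R j z a b" "w \<le>\<^sub>M z" "code_mem a b (pr z w)" for a b w
      using that D_iff[of j z w] unfolding D_def by blast
    then show "\<forall>s. Q n s" unfolding Q_def n using pr_bounds by blast
  qed
  have "{n. \<exists>s. P n s} \<in> S"
  proof (rule delta01_set[where P = P and Q = Q and v = "\<lambda>_. R" and e = "\<lambda>_. \<zero>"
      and n = "''n''" and x = "''s''" and y = "''s''" and
      p = "BEx ''a'' (Var ''s'') (BEx ''b'' (Var ''s'')
        (BEx ''j'' (Var ''n'' \<oplus> One) (BEx ''z'' (Var ''n'' \<oplus> One) (BEx ''v'' (Var ''n'' \<oplus> One)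
          (Var ''n'' \<doteq> pair (pair (Var ''j'') (Var ''z'')) (Var ''v'') \<^bold>\<and> Var ''v'' \<prec> Var ''z'' \<oplus> One \<^bold>\<and>
           Trace \<^bold>\<and> Code_mem ''a'' ''b'' (pair (Var ''z'') (Var ''v'')))))))" and
      q = "BAll ''a'' (Var ''s'') (BAll ''b'' (Var ''s'')
        (BEx ''j'' (Var ''n'' \<oplus> One) (BEx ''z'' (Var ''n'' \<oplus> One) (BEx ''v'' (Var ''n'' \<oplus> One)
          (Var ''n'' \<doteq> pair (pair (Var ''j'') (Var ''z'')) (Var ''v'') \<^bold>\<and>
           (Trace \<^bold>\<longrightarrow> BAll ''w'' (Var ''z'' \<oplus> One)
             (Code_mem ''a'' ''b'' (pair (Var ''z'') (Var ''w'')) \<^bold>\<longrightarrow> Var ''w'' \<doteq> Var ''v'')))))))"])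
  qed (simp_all add: R P_def Q_def P[unfolded P_def] Q[unfolded Q_def])
  then have "C \<in> S" by (simp add: P)
  moreover have "c j \<zero> = \<zero>" for j
    using c[of j \<zero>] unfolding D_def by (metis arith.order.antisym zero_le)
  moreover have "c j (x +\<^sub>M \<one>) = (if pr j (x +\<^sub>M \<one>) \<in> R then c j x +\<^sub>M \<one> else c j x)" for j x
  proof -
    obtain a b where ab: "c j (x +\<^sub>M \<one>) \<le>\<^sub>M x +\<^sub>M \<one>" "trace R j (x +\<^sub>M \<one>) a b"
        "code_mem a b (pr (x +\<^sub>M \<one>) (c j (x +\<^sub>M \<one>)))"
      using c[of j "x +\<^sub>M \<one>"] unfolding D_def by blast
    have x: "x \<le>\<^sub>M x +\<^sub>M \<one>" by (rule le_add)
    then obtain u where u: "u \<le>\<^sub>M x" "code_mem a b (pr x u)"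
        "c j (x +\<^sub>M \<one>) = (if pr j (x +\<^sub>M \<one>) \<in> R then u +\<^sub>M \<one> else u)"
      using ab unfolding trace_def by blast
    \<comment> \<open>A trace up to \<open>x + 1\<close> is also one up to \<open>x\<close>, so the
      predecessor it records is the count at \<open>x\<close>.\<close>
    have "D j x u" unfolding D_def using u trace_mono[OF ab(2) x] by blast
    then show ?thesis using u D_iff by simp
  qed
  moreover have "c j x \<le>\<^sub>M x" for j x
    using c[of j x] unfolding D_def by blast
  ultimately have "counts R c" unfolding counts_def C_def by blast
  then show thesis by (rule that)
qed

lemma
  assumes "counts R c"
  shows counts_set: "{i. \<exists>j x. i = pr (pr j x) (c j x)} \<in> S"
    and counts_zero: "c j \<zero> = \<zero>"
    and counts_succ: "c j (x +\<^sub>M \<one>) = (if pr j (x +\<^sub>M \<one>) \<in> R then c j x +\<^sub>M \<one> else c j x)"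
    and counts_bound: "c j x \<le>\<^sub>M x"
  using assms unfolding counts_def by blast+

section \<open>Comparison of counts\<close>

text \<open>Serves two inductions: \<open>counts_mono\<close> with \<open>w\<close> and
  \<open>d\<close> zero, \<open>counts_strict_mono\<close> with \<open>d\<close> equal to
  one.\<close>

lemma counts_compare_set:
  assumes "counts R c" "counts R' c'"
  shows "{n. n \<le>\<^sub>M x \<longrightarrow> w \<le>\<^sub>M n \<longrightarrow> c j n +\<^sub>M d \<le>\<^sub>M c' j' n} \<in> S"
proof (rule bounded_set[of "Var ''n'' \<prec> Var ''x'' \<oplus> One \<^bold>\<longrightarrow> Var ''w'' \<prec> Var ''n'' \<oplus> One \<^bold>\<longrightarrow>
    BEx ''s'' (Var ''n'' \<oplus> One) (BEx ''t'' (Var ''n'' \<oplus> One)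
      (pair (pair (Var ''j'') (Var ''n'')) (Var ''s'') \<epsilon> ''C'' \<^bold>\<and>
       pair (pair (Var ''k'') (Var ''n'')) (Var ''t'') \<epsilon> ''D'' \<^bold>\<and>
       Var ''s'' \<oplus> Var ''d'' \<prec> Var ''t'' \<oplus> One))"
    "(\<lambda>_. {i. \<exists>j x. i = pr (pr j x) (c j x)})(''D'' := {i. \<exists>j x. i = pr (pr j x) (c' j x)})"
    "(\<lambda>_. x)(''w'' := w, ''j'' := j, ''k'' := j', ''d'' := d)"])
qed (use assms in \<open>auto simp: counts_set counts_bound\<close>)

lemma counts_mono:
  assumes R: "counts R c" "counts R' c'"
    and sub: "\<And>y. y \<noteq> \<zero> \<Longrightarrow> y \<le>\<^sub>M x \<Longrightarrow> pr j y \<in> R \<Longrightarrow> pr j' y \<in> R'"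
  shows "c j x \<le>\<^sub>M c' j' x"
proof -
  have "x \<le>\<^sub>M x \<longrightarrow> \<zero> \<le>\<^sub>M x \<longrightarrow> c j x +\<^sub>M \<zero> \<le>\<^sub>M c' j' x"
  proof (rule set_induct[OF counts_compare_set[OF R]])
    fix y assume IH: "y \<le>\<^sub>M x \<longrightarrow> \<zero> \<le>\<^sub>M y \<longrightarrow> c j y +\<^sub>M \<zero> \<le>\<^sub>M c' j' y"
    have "c j (y +\<^sub>M \<one>) \<le>\<^sub>M c' j' (y +\<^sub>M \<one>)" if "y +\<^sub>M \<one> \<le>\<^sub>M x"
    proof -
      have *: "c j y \<le>\<^sub>M c' j' y" using that IH by (simp add: succ_le_iff arith.less_imp_le)
      then show ?thesis
        using sub[OF succ_neq_zero that] arith.order.trans[OF * le_add]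
        by (simp add: counts_succ[OF R(1)] counts_succ[OF R(2)])
    qed
    then show "y +\<^sub>M \<one> \<le>\<^sub>M x \<longrightarrow> \<zero> \<le>\<^sub>M y +\<^sub>M \<one> \<longrightarrow> c j (y +\<^sub>M \<one>) +\<^sub>M \<zero> \<le>\<^sub>M c' j' (y +\<^sub>M \<one>)"
      by simp
  qed (use R in \<open>simp add: counts_zero\<close>)
  then show ?thesis by simp
qed

text \<open>Below \<open>w\<close> the weak comparison holds; at \<open>w\<close> only the second
  count grows, and the gap of one persists afterwards.\<close>

lemma counts_strict_mono:
  assumes R: "counts R c" "counts R' c'"
    and sub: "\<And>y. y \<noteq> \<zero> \<Longrightarrow> y \<le>\<^sub>M x \<Longrightarrow> pr j y \<in> R \<Longrightarrow> pr j' y \<in> R'"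
    and w: "w \<noteq> \<zero>" "w \<le>\<^sub>M x" "pr j' w \<in> R'" "pr j w \<notin> R"
  shows "c j x +\<^sub>M \<one> \<le>\<^sub>M c' j' x"
proof -
  have "x \<le>\<^sub>M x \<longrightarrow> w \<le>\<^sub>M x \<longrightarrow> c j x +\<^sub>M \<one> \<le>\<^sub>M c' j' x"
  proof (rule set_induct[OF counts_compare_set[OF R]])
    show "\<zero> \<le>\<^sub>M x \<longrightarrow> w \<le>\<^sub>M \<zero> \<longrightarrow> c j \<zero> +\<^sub>M \<one> \<le>\<^sub>M c' j' \<zero>"
      using w(1) by (metis arith.order.antisym zero_le)
  next
    fix y assume IH: "y \<le>\<^sub>M x \<longrightarrow> w \<le>\<^sub>M y \<longrightarrow> c j y +\<^sub>M \<one> \<le>\<^sub>M c' j' y"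
    show "y +\<^sub>M \<one> \<le>\<^sub>M x \<longrightarrow> w \<le>\<^sub>M y +\<^sub>M \<one> \<longrightarrow> c j (y +\<^sub>M \<one>) +\<^sub>M \<one> \<le>\<^sub>M c' j' (y +\<^sub>M \<one>)"
    proof (intro impI)
      assume y: "y +\<^sub>M \<one> \<le>\<^sub>M x" "w \<le>\<^sub>M y +\<^sub>M \<one>"
      then have yx: "y \<le>\<^sub>M x" by (simp add: succ_le_iff arith.less_imp_le)
      show "c j (y +\<^sub>M \<one>) +\<^sub>M \<one> \<le>\<^sub>M c' j' (y +\<^sub>M \<one>)"
      proof (cases "w = y +\<^sub>M \<one>")
        case True
        have "c j y \<le>\<^sub>M c' j' y"
          using sub yx by (intro counts_mono[OF R]) (meson arith.order.trans)
        then show ?thesis using w True by (simp add: counts_succ[OF R(1)] counts_succ[OF R(2)])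
      next
        case False
        then have "w \<le>\<^sub>M y" using y(2) by (metis less_succ_iff arith.le_less)
        then have *: "c j y +\<^sub>M \<one> \<le>\<^sub>M c' j' y" using IH yx by blast
        then show ?thesis
          using sub[OF succ_neq_zero y(1)] arith.order.trans[OF * le_add] arith.order.trans[OF le_add *]
          by (simp add: counts_succ[OF R(1)] counts_succ[OF R(2)])
      qed
    qed
  qed
  then show ?thesis using w by simp
qed

lemma counts_mono_arg:
  assumes "counts R c"
  shows "c j x \<le>\<^sub>M c j (x +\<^sub>M y)"
proof (rule set_induct[of "\<lambda>y. c j x \<le>\<^sub>M c j (x +\<^sub>M y)"])
  show "{y. c j x \<le>\<^sub>M c j (x +\<^sub>M y)} \<in> S"
    by (rule bounded_set[of "BEx ''s'' (Var ''x'' \<oplus> Var ''n'' \<oplus> One)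
        (pair (pair (Var ''j'') (Var ''x'' \<oplus> Var ''n'')) (Var ''s'') \<epsilon> ''C'' \<^bold>\<and> Var ''d'' \<prec> Var ''s'' \<oplus> One)"
      "\<lambda>_. {i. \<exists>j x. i = pr (pr j x) (c j x)}" "(\<lambda>_. x)(''j'' := j, ''d'' := c j x)"])
    (use assms in \<open>auto simp: counts_set counts_bound\<close>)
  fix y assume *: "c j x \<le>\<^sub>M c j (x +\<^sub>M y)"
  then show "c j x \<le>\<^sub>M c j (x +\<^sub>M (y +\<^sub>M \<one>))"
    using arith.order.trans[OF * le_add] by (simp add: add_succ counts_succ[OF assms])
qed simp

lemma counts_strict_mono_arg:
  assumes R: "counts R c" and "x <\<^sub>M y" "pr j y \<in> R"
  shows "c j x <\<^sub>M c j y"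
proof -
  obtain d where d: "y = x +\<^sub>M d +\<^sub>M \<one>" using assms(2) less_iff_ex by (metis add_assoc)
  have "c j x <\<^sub>M c j (x +\<^sub>M d) +\<^sub>M \<one>" using counts_mono_arg[OF R] by simp
  then show ?thesis using assms(3) by (simp only: d counts_succ[OF R] if_True)
qed

text \<open>A discrete intermediate value argument: the count starts at zero, rises by at most one
  per step, and rises only at elements of the row.\<close>

lemma counts_surj:
  assumes R: "counts R c" "R \<in> S" and "m \<noteq> \<zero>"
  shows "m \<le>\<^sub>M c j w \<longrightarrow> (\<exists>x. x \<le>\<^sub>M w \<and> x \<noteq> \<zero> \<and> pr j x \<in> R \<and> c j x = m)"
proof (rule set_induct[of "\<lambda>w. m \<le>\<^sub>M c j w \<longrightarrow> (\<exists>x. x \<le>\<^sub>M w \<and> x \<noteq> \<zero> \<and> pr j x \<in> R \<and> c j x = m)"])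
  show "{w. m \<le>\<^sub>M c j w \<longrightarrow> (\<exists>x. x \<le>\<^sub>M w \<and> x \<noteq> \<zero> \<and> pr j x \<in> R \<and> c j x = m)} \<in> S"
    by (rule bounded_set[of "BEx ''s'' (Var ''n'' \<oplus> One) (pair (pair (Var ''j'') (Var ''n'')) (Var ''s'') \<epsilon> ''C'' \<^bold>\<and>
        (Var ''m'' \<prec> Var ''s'' \<oplus> One \<^bold>\<longrightarrow> BEx ''t'' (Var ''n'' \<oplus> One) (\<sim> Var ''t'' \<doteq> Zero \<^bold>\<and>
          pair (Var ''j'') (Var ''t'') \<epsilon> ''R'' \<^bold>\<and> pair (pair (Var ''j'') (Var ''t'')) (Var ''m'') \<epsilon> ''C'')))"
      "(\<lambda>_. R)(''C'' := {i. \<exists>j x. i = pr (pr j x) (c j x)})" "(\<lambda>_. m)(''j'' := j)"])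
    (use R in \<open>auto simp: counts_set counts_bound\<close>)
  show "m \<le>\<^sub>M c j \<zero> \<longrightarrow> (\<exists>x. x \<le>\<^sub>M \<zero> \<and> x \<noteq> \<zero> \<and> pr j x \<in> R \<and> c j x = m)"
    using \<open>m \<noteq> \<zero>\<close> by (metis counts_zero[OF R(1)] arith.order.antisym zero_le)
  fix w
  assume IH: "m \<le>\<^sub>M c j w \<longrightarrow> (\<exists>x. x \<le>\<^sub>M w \<and> x \<noteq> \<zero> \<and> pr j x \<in> R \<and> c j x = m)"
  show "m \<le>\<^sub>M c j (w +\<^sub>M \<one>) \<longrightarrow> (\<exists>x. x \<le>\<^sub>M w +\<^sub>M \<one> \<and> x \<noteq> \<zero> \<and> pr j x \<in> R \<and> c j x = m)"
  proof (cases "m \<le>\<^sub>M c j w")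
    case True
    then show ?thesis using IH le_add arith.order.trans by blast
  next
    case False
    show ?thesis
    proof
      assume m: "m \<le>\<^sub>M c j (w +\<^sub>M \<one>)"
      then have "pr j (w +\<^sub>M \<one>) \<in> R" "m \<le>\<^sub>M c j w +\<^sub>M \<one>"
        using False by (simp_all add: counts_succ[OF R(1)] split: if_splits)
      moreover from this have "c j (w +\<^sub>M \<one>) = m"
        using False by (metis counts_succ[OF R(1)] arith.le_less less_succ_iff)
      ultimately show "\<exists>x. x \<le>\<^sub>M w +\<^sub>M \<one> \<and> x \<noteq> \<zero> \<and> pr j x \<in> R \<and> c j x = m"
        using succ_neq_zero by blast
    qed
  qed
qed

section \<open>Functions and cardinality in the sense of the model\<close>

text \<open>\<open>func_on\<close>, \<open>in_seg\<close> and \<open>card_of\<close> are the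
  meanings of \<open>func\<close>, \<open>upto1\<close> and \<open>has_card\<close>; a cardinality
  requires an enumeration among the sets of the model.\<close>

definition func_on where
  "func_on F A B \<longleftrightarrow> (\<forall>z. z \<in> F \<longrightarrow> (\<exists>x y. A x \<and> B y \<and> z = pr x y)) \<and>
    (\<forall>x. A x \<longrightarrow> (\<exists>y. pr x y \<in> F \<and> (\<forall>z. pr x z \<in> F \<longrightarrow> z = y)))"

definition in_seg where "in_seg n i \<longleftrightarrow> \<one> \<le>\<^sub>M i \<and> i \<le>\<^sub>M n"

definition card_of where
  "card_of A n \<longleftrightarrow> (\<exists>E\<in>S. func_on E (in_seg n) A \<and>
    (\<forall>y. A y \<longrightarrow> (\<exists>x. pr x y \<in> E \<and> (\<forall>z. pr z y \<in> E \<longrightarrow> z = x))))"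

lemma in_seg_iff: "in_seg n i \<longleftrightarrow> i \<noteq> \<zero> \<and> i \<le>\<^sub>M n"
  by (simp add: in_seg_def one_le_iff)

lemma func_on_pr: "func_on F A B \<Longrightarrow> pr x y \<in> F \<Longrightarrow> A x \<and> B y"
  unfolding func_on_def by fastforce

text \<open>The enumeration is the increasing one: an element \<open>x\<close> has index
  \<open>c j x\<close>. Distinct elements have distinct indices since the count rises strictly at
  elements, and every index occurs by \<open>counts_surj\<close>.\<close>

lemma card_of_counts:
  assumes R: "counts R c" "R \<in> S"
  shows "card_of (\<lambda>x. pr j x \<in> R \<and> in_seg w x) (c j w)"
proof -
  define E where "E = {n. \<exists>x. x \<le>\<^sub>M n \<and> (\<exists>s. s \<le>\<^sub>M n \<and> n = pr s x \<and> s = c j x \<and>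
    pr j x \<in> R \<and> x \<noteq> \<zero> \<and> x \<le>\<^sub>M w)}"
  have E_iff: "pr i x \<in> E \<longleftrightarrow> i = c j x \<and> pr j x \<in> R \<and> in_seg w x" for i x
    by (auto simp: E_def in_seg_iff le_pr)
  have "E \<in> S"
    unfolding E_def
    by (rule bounded_set[of "BEx ''x'' (Var ''n'' \<oplus> One) (BEx ''s'' (Var ''n'' \<oplus> One)
        (Var ''n'' \<doteq> pair (Var ''s'') (Var ''x'') \<^bold>\<and>
         pair (pair (Var ''j'') (Var ''x'')) (Var ''s'') \<epsilon> ''C'' \<^bold>\<and> pair (Var ''j'') (Var ''x'') \<epsilon> ''R'' \<^bold>\<and>
         \<sim> Var ''x'' \<doteq> Zero \<^bold>\<and> Var ''x'' \<prec> Var ''w'' \<oplus> One))"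
      "(\<lambda>_. R)(''C'' := {i. \<exists>j x. i = pr (pr j x) (c j x)})" "(\<lambda>_. w)(''j'' := j)"])
      (use R in \<open>auto simp: counts_set\<close>)
  have inj: "x = y" if "c j x = c j y" "pr j x \<in> R" "pr j y \<in> R" for x y
  proof (rule arith.linorder_cases[of x y])
    assume "x <\<^sub>M y"
    then show ?thesis using counts_strict_mono_arg[OF R(1) _ that(3), of x] that(1) by (simp add: less_irrefl)
  next
    assume "y <\<^sub>M x"
    then show ?thesis using counts_strict_mono_arg[OF R(1) _ that(2), of y] that(1) by (simp add: less_irrefl)
  qed
  have range: "in_seg (c j w) (c j x)" if "pr j x \<in> R" "in_seg w x" for x
  proof -
    obtain d where "w = x +\<^sub>M d" using \<open>in_seg w x\<close> by (auto simp: in_seg_iff le_iff_ex)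
    then have "c j x \<le>\<^sub>M c j w" using counts_mono_arg[OF R(1)] by simp
    moreover have "\<zero> <\<^sub>M x" using \<open>in_seg w x\<close> by (simp add: in_seg_iff zero_less_iff)
    then have "c j \<zero> <\<^sub>M c j x" using counts_strict_mono_arg[OF R(1)] that by blast
    ultimately show ?thesis by (simp add: in_seg_iff counts_zero[OF R(1)] zero_less_iff)
  qed
  have "func_on E (in_seg (c j w)) (\<lambda>x. pr j x \<in> R \<and> in_seg w x)"
    unfolding func_on_def
  proof (intro conjI allI impI)
    fix z assume "z \<in> E"
    then obtain i x where "z = pr i x" by (auto simp: E_def)
    then show "\<exists>i x. in_seg (c j w) i \<and> (pr j x \<in> R \<and> in_seg w x) \<and> z = pr i x"
      using \<open>z \<in> E\<close> range by (auto simp: E_iff)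
  next
    fix i assume "in_seg (c j w) i"
    then obtain x where "pr i x \<in> E"
      using counts_surj[OF R, of i j w] unfolding E_iff in_seg_iff by blast
    then show "\<exists>x. pr i x \<in> E \<and> (\<forall>y. pr i y \<in> E \<longrightarrow> y = x)"
      using inj by (intro exI[of _ x]) (simp add: E_iff)
  qed
  moreover have "\<exists>i. pr i x \<in> E \<and> (\<forall>l. pr l x \<in> E \<longrightarrow> l = i)" if "pr j x \<in> R \<and> in_seg w x" for x
    using that unfolding E_iff by blast
  ultimately show ?thesis
    unfolding card_of_def using \<open>E \<in> S\<close> by blast
qed

text \<open>If \<open>E\<close> enumerates \<open>G\<close>, the number of elements of $E(\{1, \dots, j\})$ grows at every step from
  \<open>j\<close> to $j + 1$, hence it is at least \<open>j\<close>.\<close>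

lemma card_of_le_counts:
  assumes R: "counts R c" and G: "card_of G m" "\<And>x. G x \<Longrightarrow> pr i x \<in> R \<and> in_seg w x"
  shows "m \<le>\<^sub>M c i w"
proof -
  obtain E where E: "E \<in> S" "func_on E (in_seg m) G"
      "\<And>y. G y \<Longrightarrow> \<exists>x. pr x y \<in> E \<and> (\<forall>z. pr z y \<in> E \<longrightarrow> z = x)"
    using G(1) unfolding card_of_def by blast
  \<comment> \<open>Row \<open>j\<close> of \<open>Q\<close> is the image of {1, ..., j} under
    \<open>E\<close>, so \<open>c' j w\<close> below counts this image.\<close>
  define Q where "Q = {n. \<exists>j. j \<le>\<^sub>M n \<and> (\<exists>x. x \<le>\<^sub>M n \<and> n = pr j x \<and> (\<exists>t. t \<le>\<^sub>M j \<and> pr t x \<in> E))}"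
  have Q_iff: "pr j x \<in> Q \<longleftrightarrow> (\<exists>t. t \<le>\<^sub>M j \<and> pr t x \<in> E)" for j x
    by (auto simp: Q_def le_pr)
  have "Q \<in> S"
    unfolding Q_def
    by (rule bounded_set[of "BEx ''j'' (Var ''n'' \<oplus> One) (BEx ''x'' (Var ''n'' \<oplus> One)
        (Var ''n'' \<doteq> pair (Var ''j'') (Var ''x'') \<^bold>\<and>
         BEx ''t'' (Var ''j'' \<oplus> One) (pair (Var ''t'') (Var ''x'') \<epsilon> ''E'')))" "\<lambda>_. E"])
      (simp_all add: E)
  then obtain c' where c': "counts Q c'" by (rule counts_exists)
  have "m \<le>\<^sub>M m \<longrightarrow> m \<le>\<^sub>M c' m w"
  proof (rule set_induct[of "\<lambda>j. j \<le>\<^sub>M m \<longrightarrow> j \<le>\<^sub>M c' j w"])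
    show "{j. j \<le>\<^sub>M m \<longrightarrow> j \<le>\<^sub>M c' j w} \<in> S"
      by (rule bounded_set[of "Var ''n'' \<prec> Var ''m'' \<oplus> One \<^bold>\<longrightarrow> BEx ''s'' (Var ''w'' \<oplus> One)
          (pair (pair (Var ''n'') (Var ''w'')) (Var ''s'') \<epsilon> ''C'' \<^bold>\<and> Var ''n'' \<prec> Var ''s'' \<oplus> One)"
        "\<lambda>_. {i. \<exists>j x. i = pr (pr j x) (c' j x)}" "(\<lambda>_. m)(''w'' := w)"])
      (use c' in \<open>auto simp: counts_set counts_bound\<close>)
    fix j assume IH: "j \<le>\<^sub>M m \<longrightarrow> j \<le>\<^sub>M c' j w"
    show "j +\<^sub>M \<one> \<le>\<^sub>M m \<longrightarrow> j +\<^sub>M \<one> \<le>\<^sub>M c' (j +\<^sub>M \<one>) w"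
    proof
      assume jm: "j +\<^sub>M \<one> \<le>\<^sub>M m"
      then have "in_seg m (j +\<^sub>M \<one>)" by (simp add: in_seg_iff succ_neq_zero)
      then obtain y where y: "pr (j +\<^sub>M \<one>) y \<in> E" using E(2) unfolding func_on_def by blast
      then have "G y" using func_on_pr[OF E(2)] by blast
      then have "y \<noteq> \<zero>" "y \<le>\<^sub>M w" using G(2) by (auto simp: in_seg_iff)
      \<comment> \<open>\<open>j + 1\<close> is the only index of \<open>y\<close> in
        \<open>E\<close>, so \<open>y\<close> is new in row \<open>j + 1\<close>.\<close>
      have "\<not> j +\<^sub>M \<one> \<le>\<^sub>M j" by (simp add: succ_le_iff less_irrefl)
      then have "pr j y \<notin> Q" using E(3)[OF \<open>G y\<close>] y unfolding Q_iff by metis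
      moreover have "pr (j +\<^sub>M \<one>) y \<in> Q" using y unfolding Q_iff by blast
      moreover have "pr j x \<in> Q \<Longrightarrow> pr (j +\<^sub>M \<one>) x \<in> Q" for x
        unfolding Q_iff using arith.order.trans le_add by blast
      ultimately have "c' j w +\<^sub>M \<one> \<le>\<^sub>M c' (j +\<^sub>M \<one>) w"
        using \<open>y \<noteq> \<zero>\<close> \<open>y \<le>\<^sub>M w\<close> by (intro counts_strict_mono[OF c' c'])
      moreover have "j \<le>\<^sub>M c' j w"
        using IH jm by (simp add: succ_le_iff arith.less_imp_le)
      then have "j +\<^sub>M \<one> \<le>\<^sub>M c' j w +\<^sub>M \<one>" by (rule arith.add_right_mono)
      ultimately show "j +\<^sub>M \<one> \<le>\<^sub>M c' (j +\<^sub>M \<one>) w" by (rule arith.order.trans[rotated])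
    qed
  qed simp
  \<comment> \<open>Row \<open>m\<close> consists of elements of \<open>G\<close>, all of which lie
    in row \<open>i\<close> of \<open>R\<close>.\<close>
  moreover have "c' m w \<le>\<^sub>M c i w"
    using G(2) func_on_pr[OF E(2)] by (intro counts_mono[OF c' R]) (auto simp: Q_iff)
  ultimately show ?thesis using arith.order.trans by blast
qed

text \<open>The order of the model may be ill-founded from outside, but sets of the model have
  minima, by induction on \<open>n\<close> for the claim that no element is at most
  \<open>n\<close>.\<close>

lemma least_element:
  assumes "A \<in> S" "a \<in> A"
  obtains b where "b \<in> A" "\<And>x. x <\<^sub>M b \<Longrightarrow> x \<notin> A"
proof (rule ccontr)
  assume no: "\<not> thesis"
  have "\<forall>x. x \<le>\<^sub>M a \<longrightarrow> x \<notin> A"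
  proof (rule set_induct[of "\<lambda>n. \<forall>x. x \<le>\<^sub>M n \<longrightarrow> x \<notin> A"])
    show "{n. \<forall>x. x \<le>\<^sub>M n \<longrightarrow> x \<notin> A} \<in> S"
      by (rule bounded_set[of "BAll ''x'' (Var ''n'' \<oplus> One) (\<sim> Var ''x'' \<epsilon> ''A'')" "\<lambda>_. A"])
        (simp_all add: assms)
    show "\<forall>x. x \<le>\<^sub>M \<zero> \<longrightarrow> x \<notin> A"
      using no that[of \<zero>] not_less_zero by (metis le_M_def)
    fix n assume "\<forall>x. x \<le>\<^sub>M n \<longrightarrow> x \<notin> A"
    then show "\<forall>x. x \<le>\<^sub>M n +\<^sub>M \<one> \<longrightarrow> x \<notin> A"
      using no that[of "n +\<^sub>M \<one>"] less_succ_iff unfolding le_M_def[of _ "n +\<^sub>M \<one>"] by blast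
  qed
  then show False using assms(2) by simp
qed

section \<open>The colouring argument\<close>

definition arrow where
  "arrow w m k \<longleftrightarrow> (\<forall>A\<in>S. card_of (\<lambda>x. x \<in> A) w \<longrightarrow>
    (\<forall>C\<in>S. func_on C (\<lambda>x. x \<in> A) (in_seg k) \<longrightarrow>
      (\<exists>G\<in>S. (\<forall>x. x \<in> G \<longrightarrow> x \<in> A) \<and> card_of (\<lambda>x. x \<in> G) m \<and>
        (\<exists>c. \<forall>x. x \<in> G \<longrightarrow> pr x c \<in> C))))"

text \<open>\<open>F\<close> restricted to {1, ..., w} is in particular a colouring with
  \<open>k + 1\<close> colours, and a monochromatic set of size \<open>m\<close> bounds the count of
  its colour from below.\<close>

lemma exists_large_colour:
  assumes F: "F \<in> S" "func_on F (\<lambda>_. True) (in_seg k)"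
    and arrow: "arrow w m (k +\<^sub>M \<one>)"
    and c: "counts R c" "\<And>j x. pr j x \<in> R \<longleftrightarrow> pr x j \<in> F"
  shows "\<exists>i. in_seg k i \<and> m \<le>\<^sub>M c i w"
proof (cases "m = \<zero>")
  case True
  \<comment> \<open>For \<open>m = \<zero>\<close> the monochromatic set may be empty and its colour
    out of range, so the colour of zero serves as default.\<close>
  obtain i where "pr \<zero> i \<in> F" using F(2) unfolding func_on_def by blast
  then show ?thesis using True func_on_pr[OF F(2)] by auto
next
  case False
  have A: "{x. in_seg w x} \<in> S"
    unfolding in_seg_iff
    by (rule bounded_set[of "\<sim> Var ''n'' \<doteq> Zero \<^bold>\<and> Var ''n'' \<prec> Var ''w'' \<oplus> One" "\<lambda>_. F" "\<lambda>_. w"])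
      (simp_all add: F)
  \<comment> \<open>The identity on {1, ..., w}, as an enumeration of this segment.\<close>
  have "{n. \<exists>x. x \<le>\<^sub>M n \<and> n = pr x x \<and> x \<noteq> \<zero> \<and> x \<le>\<^sub>M w} \<in> S"
    by (rule bounded_set[of "BEx ''x'' (Var ''n'' \<oplus> One) (Var ''n'' \<doteq> pair (Var ''x'') (Var ''x'') \<^bold>\<and>
        \<sim> Var ''x'' \<doteq> Zero \<^bold>\<and> Var ''x'' \<prec> Var ''w'' \<oplus> One)" "\<lambda>_. F" "\<lambda>_. w"])
      (simp_all add: F)
  then have card: "card_of (\<lambda>x. x \<in> {x. in_seg w x}) w"
    unfolding card_of_def by (rule bexI[rotated]) (auto simp: func_on_def in_seg_iff le_pr)
  define C where "C = {n. n \<in> F \<and> (\<exists>x. x \<le>\<^sub>M n \<and> (\<exists>y. y \<le>\<^sub>M n \<and> n = pr x y \<and> x \<noteq> \<zero> \<and> x \<le>\<^sub>M w))}"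
  have "C \<in> S"
    unfolding C_def
    by (rule bounded_set[of "Var ''n'' \<epsilon> ''F'' \<^bold>\<and> BEx ''x'' (Var ''n'' \<oplus> One) (BEx ''y'' (Var ''n'' \<oplus> One)
        (Var ''n'' \<doteq> pair (Var ''x'') (Var ''y'') \<^bold>\<and>
         \<sim> Var ''x'' \<doteq> Zero \<^bold>\<and> Var ''x'' \<prec> Var ''w'' \<oplus> One))" "\<lambda>_. F" "\<lambda>_. w"])
      (simp_all add: F)
  have C_iff: "pr x y \<in> C \<longleftrightarrow> pr x y \<in> F \<and> in_seg w x" for x y
    by (auto simp: C_def in_seg_iff le_pr)
  have "func_on C (\<lambda>x. x \<in> {x. in_seg w x}) (in_seg (k +\<^sub>M \<one>))"
    unfolding func_on_def
  proof (intro conjI allI impI)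
    fix z assume "z \<in> C"
    then obtain x y where z: "z = pr x y" "pr x y \<in> F" "in_seg w x"
      by (auto simp: C_def in_seg_iff)
    then have "in_seg k y" using func_on_pr[OF F(2)] by blast
    then have "in_seg (k +\<^sub>M \<one>) y" unfolding in_seg_iff using le_add arith.order.trans by blast
    then show "\<exists>x y. x \<in> {x. in_seg w x} \<and> in_seg (k +\<^sub>M \<one>) y \<and> z = pr x y" using z by blast
  next
    fix x assume "x \<in> {x. in_seg w x}"
    then show "\<exists>y. pr x y \<in> C \<and> (\<forall>z. pr x z \<in> C \<longrightarrow> z = y)"
      using F(2) unfolding C_iff func_on_def by blast
  qed
  then obtain G i where G: "\<And>x. x \<in> G \<Longrightarrow> in_seg w x" "card_of (\<lambda>x. x \<in> G) m"
      "\<And>x. x \<in> G \<Longrightarrow> pr x i \<in> C"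
    using arrow[unfolded arrow_def, THEN bspec, OF A, THEN mp, OF card, THEN bspec, OF \<open>C \<in> S\<close>]
    by (auto simp only: mem_Collect_eq)
  \<comment> \<open>As \<open>m\<close> is nonzero, \<open>G\<close> has an element; it has colour
    \<open>i\<close> under \<open>F\<close>, so \<open>i\<close> is one of the \<open>k\<close>
    colours.\<close>
  have "in_seg m \<one>" using False by (simp add: in_seg_iff one_le_iff)
  moreover obtain E where E: "func_on E (in_seg m) (\<lambda>x. x \<in> G)"
    using G(2) unfolding card_of_def by blast
  ultimately obtain x where "pr \<one> x \<in> E" unfolding func_on_def by blast
  then have "x \<in> G" using func_on_pr[OF E] by blast
  then have "in_seg k i" using G(3) func_on_pr[OF F(2)] C_iff by blast
  moreover have "m \<le>\<^sub>M c i w"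
    using G c(2) C_iff by (intro card_of_le_counts[OF c(1) G(2)]) blast
  ultimately show ?thesis by blast
qed

lemma RT1_imp_PRT1:
  assumes RT: "\<And>F. F \<in> S \<Longrightarrow> func_on F (\<lambda>_. True) (in_seg k) \<Longrightarrow>
      \<exists>H\<in>S. (\<forall>b. \<exists>x. b <\<^sub>M x \<and> x \<in> H) \<and> (\<exists>c. \<forall>x. x \<in> H \<longrightarrow> pr x c \<in> F)"
    and Phi: "\<Phi> \<in> S" "func_on \<Phi> (\<lambda>_. True) (\<lambda>_. True)"
      "\<And>w m. pr w m \<in> \<Phi> \<Longrightarrow> arrow w m (k +\<^sub>M \<one>)"
    and F: "F \<in> S" "func_on F (\<lambda>_. True) (in_seg k)"
  shows "\<exists>H\<in>S. (\<forall>b. \<exists>w. b <\<^sub>M w \<and> (\<exists>m. pr w m \<in> \<Phi> \<and>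
      (\<exists>n. card_of (\<lambda>x. x \<in> H \<and> in_seg w x) n \<and> m \<le>\<^sub>M n))) \<and>
    (\<exists>c. \<forall>x. x \<in> H \<longrightarrow> pr x c \<in> F)"
proof -
  \<comment> \<open>The transpose of \<open>F\<close>: row \<open>i\<close> is the class of colour
    \<open>i\<close>, so that \<open>c i w\<close> counts this class.\<close>
  define R where "R = {n. \<exists>j. j \<le>\<^sub>M n \<and> (\<exists>x. x \<le>\<^sub>M n \<and> n = pr j x \<and> pr x j \<in> F)}"
  have R_iff: "pr j x \<in> R \<longleftrightarrow> pr x j \<in> F" for j x
    by (auto simp: R_def le_pr)
  have "R \<in> S"
    unfolding R_def
    by (rule bounded_set[of "BEx ''j'' (Var ''n'' \<oplus> One) (BEx ''x'' (Var ''n'' \<oplus> One)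
        (Var ''n'' \<doteq> pair (Var ''j'') (Var ''x'') \<^bold>\<and> pair (Var ''x'') (Var ''j'') \<epsilon> ''F''))" "\<lambda>_. F"])
      (simp_all add: F)
  then obtain c where c: "counts R c" by (rule counts_exists)
  \<comment> \<open>Only values of \<open>\<Phi>\<close> up to the count \<open>s\<close> matter, so
    the quantifier over \<open>m\<close> is bounded by \<open>s\<close> and that over
    \<open>s\<close> by \<open>w\<close>.\<close>
  define L where "L = {n. \<exists>w. w \<le>\<^sub>M n \<and> (\<exists>i. i \<le>\<^sub>M n \<and> n = pr w i \<and> i \<noteq> \<zero> \<and> i \<le>\<^sub>M k \<and>
    (\<exists>s. s \<le>\<^sub>M w \<and> s = c i w \<and> (\<exists>m. m \<le>\<^sub>M s \<and> pr w m \<in> \<Phi>)))}"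
  have L_iff: "pr w i \<in> L \<longleftrightarrow> in_seg k i \<and> (\<exists>m. m \<le>\<^sub>M c i w \<and> pr w m \<in> \<Phi>)" for w i
    using counts_bound[OF c] by (auto simp: L_def in_seg_iff le_pr)
  have "L \<in> S"
    unfolding L_def
    by (rule bounded_set[of "BEx ''w'' (Var ''n'' \<oplus> One) (BEx ''i'' (Var ''n'' \<oplus> One)
        (Var ''n'' \<doteq> pair (Var ''w'') (Var ''i'') \<^bold>\<and> \<sim> Var ''i'' \<doteq> Zero \<^bold>\<and> Var ''i'' \<prec> Var ''k'' \<oplus> One \<^bold>\<and>
         BEx ''s'' (Var ''w'' \<oplus> One) (pair (pair (Var ''i'') (Var ''w'')) (Var ''s'') \<epsilon> ''C'' \<^bold>\<and>
           BEx ''m'' (Var ''s'' \<oplus> One) (pair (Var ''w'') (Var ''m'') \<epsilon> ''Phi''))))"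
        "(\<lambda>_. \<Phi>)(''C'' := {i. \<exists>j x. i = pr (pr j x) (c j x)})" "\<lambda>_. k"])
      (use c Phi(1) in \<open>auto simp: counts_set\<close>)
  \<comment> \<open>Choosing the least large colour makes \<open>g\<close> single-valued, and
    minimality is a bounded condition.\<close>
  define g where "g = {n. \<exists>w. w \<le>\<^sub>M n \<and> (\<exists>i. i \<le>\<^sub>M n \<and> n = pr w i \<and> pr w i \<in> L \<and>
    (\<forall>t. t <\<^sub>M i \<longrightarrow> pr w t \<notin> L))}"
  have g_iff: "pr w i \<in> g \<longleftrightarrow> pr w i \<in> L \<and> (\<forall>t. t <\<^sub>M i \<longrightarrow> pr w t \<notin> L)" for w i
    by (auto simp: g_def le_pr)
  have "g \<in> S"
    unfolding g_def
    by (rule bounded_set[of "BEx ''w'' (Var ''n'' \<oplus> One) (BEx ''i'' (Var ''n'' \<oplus> One)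
        (Var ''n'' \<doteq> pair (Var ''w'') (Var ''i'') \<^bold>\<and> pair (Var ''w'') (Var ''i'') \<epsilon> ''L'' \<^bold>\<and>
         BAll ''t'' (Var ''i'') (\<sim> pair (Var ''w'') (Var ''t'') \<epsilon> ''L'')))" "\<lambda>_. L"])
      (simp_all add: \<open>L \<in> S\<close>)
  have func: "func_on g (\<lambda>_. True) (in_seg k)"
    unfolding func_on_def
  proof (intro conjI allI impI)
    fix z assume "z \<in> g"
    then obtain w i where "z = pr w i" "pr w i \<in> L" unfolding g_def by blast
    then show "\<exists>w i. True \<and> in_seg k i \<and> z = pr w i" unfolding L_iff by blast
  next
    fix w
    have L_w: "{i. pr w i \<in> L} \<in> S"
      by (rule bounded_set[of "pair (Var ''w'') (Var ''n'') \<epsilon> ''L''" "\<lambda>_. L" "\<lambda>_. w"])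
        (simp_all add: \<open>L \<in> S\<close>)
    obtain m where m: "pr w m \<in> \<Phi>" using Phi(2) unfolding func_on_def by blast
    obtain l where "pr w l \<in> L"
      using exists_large_colour[OF F Phi(3)[OF m] c R_iff] m unfolding L_iff by blast
    then have "l \<in> {i. pr w i \<in> L}" by simp
    then obtain i where "i \<in> {i. pr w i \<in> L}" "\<And>t. t <\<^sub>M i \<Longrightarrow> t \<notin> {i. pr w i \<in> L}"
      using least_element[OF L_w] by metis
    then have "pr w i \<in> g" by (simp add: g_iff)
    moreover have "j = i" if "pr w j \<in> g" for j
      using that \<open>pr w i \<in> g\<close> unfolding g_iff by (metis less_linear)
    ultimately show "\<exists>i. pr w i \<in> g \<and> (\<forall>j. pr w j \<in> g \<longrightarrow> j = i)" by blast
  qed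
  obtain W i where W: "\<And>b. \<exists>w. b <\<^sub>M w \<and> w \<in> W" "\<And>w. w \<in> W \<Longrightarrow> pr w i \<in> g"
    using RT[OF \<open>g \<in> S\<close> func] by blast
  \<comment> \<open>The solution is the whole colour class, not the set \<open>W\<close> on which
    \<open>g\<close> is constant: \<open>W\<close> only supplies the lengths \<open>w\<close> at
    which the class is large.\<close>
  have "{x. pr x i \<in> F} \<in> S"
    by (rule bounded_set[of "pair (Var ''n'') (Var ''i'') \<epsilon> ''F''" "\<lambda>_. F" "\<lambda>_. i"])
      (simp_all add: F)
  moreover have "\<exists>w. b <\<^sub>M w \<and> (\<exists>m. pr w m \<in> \<Phi> \<and>
      (\<exists>n. card_of (\<lambda>x. x \<in> {x. pr x i \<in> F} \<and> in_seg w x) n \<and> m \<le>\<^sub>M n))" for b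
  proof -
    obtain w where w: "b <\<^sub>M w" "w \<in> W" using W(1) by blast
    then have "pr w i \<in> L" using W(2) g_iff by blast
    then obtain m where "m \<le>\<^sub>M c i w" "pr w m \<in> \<Phi>" using L_iff by blast
    moreover have "card_of (\<lambda>x. x \<in> {x. pr x i \<in> F} \<and> in_seg w x) (c i w)"
      using card_of_counts[OF c \<open>R \<in> S\<close>, of i w] by (simp add: R_iff)
    ultimately show ?thesis using w(1) by blast
  qed
  ultimately show ?thesis by (intro bexI[of _ "{x. pr x i \<in> F}"]) auto
qed

section \<open>The formulas and their meaning in the model\<close>

lemma Leq_iff: "a <\<^sub>M b \<or> a = b \<longleftrightarrow> a \<le>\<^sub>M b"
  by (simp add: le_M_def)

text \<open>The excluded names are those bound inside \<open>has_card\<close>, which would capture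
  \<open>X\<close> or \<open>n\<close>.\<close>

lemma sat_has_card_mem:
  assumes "X \<noteq> ''E''" "n \<notin> {''x'', ''y'', ''z''}"
  shows "sat M e v (has_card (\<lambda>t. t \<epsilon> X) (Var n)) \<longleftrightarrow> card_of (\<lambda>x. x \<in> v X) (e n)"
  using assms by (simp add: has_card_def bijection_def func_def upto1_def Let_def card_of_def
      func_on_def in_seg_def Leq_iff)

text \<open>In \<open>packed\<close> the counted class is an intersection rather than a single set
  variable.\<close>

lemma sat_has_card_segment:
  "sat M e v (has_card (\<lambda>t. t \<epsilon> ''H'' \<^bold>\<and> upto1 (Var ''w'') t) (Var ''n'')) \<longleftrightarrow>
    card_of (\<lambda>x. x \<in> v ''H'' \<and> in_seg (e ''w'') x) (e ''n'')"
  by (simp add: has_card_def bijection_def func_def upto1_def Let_def card_of_def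
      func_on_def in_seg_def Leq_iff)

lemma sat_RT1:
  "sat M e v (RT1 (Var ''k'')) \<longleftrightarrow> (\<forall>F\<in>S. func_on F (\<lambda>_. True) (in_seg (e ''k'')) \<longrightarrow>
    (\<exists>H\<in>S. (\<forall>b. \<exists>x. b <\<^sub>M x \<and> x \<in> H) \<and> (\<exists>c. \<forall>x. x \<in> H \<longrightarrow> pr x c \<in> F)))"
  by (simp add: RT1_def func_def upto1_def all_numbers_def infinite_set_def const_on_def Let_def
      func_on_def in_seg_def Leq_iff)

lemma sat_arrow1:
  "sat M e v (arrow1 (Var ''w'') (Var ''m'') (Var ''k'' \<oplus> One)) \<longleftrightarrow>
    arrow (e ''w'') (e ''m'') (e ''k'' +\<^sub>M \<one>)"
  \<comment> \<open>\<open>less_succ_iff\<close> would turn \<open>i < k + 1\<close> into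
    \<open>i \<le> k\<close> before it can join with \<open>i = k + 1\<close> to form
    \<open>i \<le> k + 1\<close>.\<close>
  by (simp add: arrow1_def arrow_def sat_has_card_mem func_def upto1_def const_on_def Let_def
      func_on_def in_seg_def Leq_iff del: less_succ_iff)

lemma sat_PRT1:
  "sat M e v (PRT1 (Var ''k'')) \<longleftrightarrow> (\<forall>\<Phi>\<in>S. func_on \<Phi> (\<lambda>_. True) (\<lambda>_. True) \<and>
    (\<forall>w m. pr w m \<in> \<Phi> \<longrightarrow> arrow w m (e ''k'' +\<^sub>M \<one>)) \<longrightarrow>
    (\<forall>F\<in>S. func_on F (\<lambda>_. True) (in_seg (e ''k'')) \<longrightarrow>
      (\<exists>H\<in>S. (\<forall>b. \<exists>w. b <\<^sub>M w \<and> (\<exists>m. pr w m \<in> \<Phi> \<and>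
          (\<exists>n. card_of (\<lambda>x. x \<in> H \<and> in_seg w x) n \<and> m \<le>\<^sub>M n))) \<and>
        (\<exists>c. \<forall>x. x \<in> H \<longrightarrow> pr x c \<in> F))))"
  by (simp add: PRT1_def packed_def sat_arrow1 sat_has_card_segment[unfolded upto1_def] func_def upto1_def
      all_numbers_def const_on_def Let_def func_on_def in_seg_def Leq_iff)

end

text \<open>The number of colours \<open>k\<close> is any element of \<open>M\<close>, possibly
  nonstandard; \<open>RT1\<close> is applied at the same \<open>k\<close> at which
  \<open>PRT1\<close> is proved.\<close>

theorem theorem1p8:
  fixes M :: "'a l2_struct"
  assumes "model_of M RCA0"
  shows "M \<Turnstile> All ''k'' (RT1 (Var ''k'') \<^bold>\<longrightarrow> PRT1 (Var ''k''))"
proof -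
  interpret rca0 M using assms by unfold_locales
  show ?thesis
    unfolding holds_def sat.simps sat_RT1 sat_PRT1
    by (intro allI impI ballI, elim conjE) (rule RT1_imp_PRT1; simp)
qed

end
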